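(* There is a trivial computable probability measure $\mu$ on $2^\omega$ such that (i) $\mathsf{2MLR}_\mu=\mathsf{Atoms}_\mu$, and (ii) $\mathsf{MLR}_\mu\setminus\mathsf{2MLR}_\mu\neq\emptyset$.
   Context: $2^\omega$ is Cantor space (infinite binary sequences), $2^{<\omega}$ the set of finite binary strings, and $[\![\sigma]\!]$ the set of $X\in 2^\omega$ extending $\sigma$. A probability measure $\mu$ on $2^\omega$ is computable if $\sigma\mapsto\mu([\![\sigma]\!])$ is a computable real-valued function, i.e. there is a computable function $\widehat\mu:2^{<\omega}\times\omega\to\mathbb{Q}_2$ (dyadic rationals) with $|\mu([\![\sigma]\!])-\widehat\mu(\sigma,i)|\le 2^{-i}$ for all $\sigma,i$. $\mathsf{Atoms}_\mu=\{A\in 2^\omega:\mu(\{A\})>0\}$, and $\mu$ is trivial if $\mu(\mathsf{Atoms}_\mu)=1$. For $A\in 2^\omega$, a $\mu$-Martin-Löf test relative to $A$ is a sequence $(\mathcal U_i)_{i\in\omega}$ of uniformly $\Sigma^{0}_1$-in-$A$ (uniformly $A$-effectively open) subsets of $2^\omega$ with $\mu(\mathcal U_i)\le 2^{-i}$ for all $i$; $\mathsf{MLR}^A_\mu$ is the set of $X\in 2^\omega$ with $X\notin\bigcap_i\mathcal U_i$ for every such test. $\mathsf{MLR}_\mu=\mathsf{MLR}_\mu^{\emptyset}$, and $\mathsf{2MLR}_\mu=\mathsf{MLR}_\mu^{\emptyset'}$, where $\emptyset'$ is the halting set. *)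

theory Defs
  imports "HOL-Probability.Probability" "HOL-Library.Nat_Bijection"
begin

section \<open>Oracle computability\<close>

text \<open>
  Points of Cantor space are functions \<open>nat \<Rightarrow> bool\<close> with the product topology of the library.
  An oracle is such a point, read as the characteristic function of a set of natural numbers.
\<close>

type_synonym cantor = "nat \<Rightarrow> bool"

text \<open>
  Partial recursive functions relative to an oracle, in unary form: several arguments are
  combined by the Cantor pairing function \<^const>\<open>prod_encode\<close>. The identity is \<open>Pr Fst Snd\<close>, because
  the pairing is surjective.
\<close>

datatype prog =
    Zero
  | Succ
  | Fst
  | Snd
  | Query
  | Pr prog prog
  | Comp prog prog
  | PrimRec prog prog
  | Mu prog

text \<open>
  \<open>run A p x\<close> is the value at \<open>x\<close> of the partial function computed by \<open>p\<close> with oracle \<open>A\<close>, where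
  \<^const>\<open>None\<close> means divergence. \<open>Mu p\<close> is unbounded search: the computation of \<open>p\<close> has to converge on all
  candidates below the answer.
\<close>

primrec run :: "cantor \<Rightarrow> prog \<Rightarrow> nat \<Rightarrow> nat option" where
  "run A Zero = (\<lambda>x. Some 0)"
| "run A Succ = (\<lambda>x. Some (Suc x))"
| "run A Fst = (\<lambda>x. Some (fst (prod_decode x)))"
| "run A Snd = (\<lambda>x. Some (snd (prod_decode x)))"
| "run A Query = (\<lambda>x. Some (if A x then 1 else 0))"
| "run A (Pr p q) = (\<lambda>x. Option.bind (run A p x) (\<lambda>y.
     Option.bind (run A q x) (\<lambda>z. Some (prod_encode (y, z)))))"
| "run A (Comp p q) = (\<lambda>x. Option.bind (run A q x) (run A p))"
| "run A (PrimRec p q) = (\<lambda>x. case prod_decode x of (a, n) \<Rightarrow>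
     rec_nat (run A p a)
       (\<lambda>k r. Option.bind r (\<lambda>y. run A q (prod_encode (a, prod_encode (k, y))))) n)"
| "run A (Mu p) = (\<lambda>x.
     let found = (\<lambda>n. run A p (prod_encode (x, n)) = Some 0 \<and>
                     (\<forall>m<n. \<exists>k. run A p (prod_encode (x, m)) = Some (Suc k)))
     in if \<exists>n. found n then Some (LEAST n. found n) else None)"

text \<open>
  The Goedel numbering is explicit, since an arbitrary injection into the natural numbers would not
  give an effective numbering.
\<close>

primrec prog_num :: "prog \<Rightarrow> nat" where
  "prog_num Zero = 0"
| "prog_num Succ = 1"
| "prog_num Fst = 2"
| "prog_num Snd = 3"
| "prog_num Query = 4"
| "prog_num (Pr p q) = 5 + 4 * prod_encode (prog_num p, prog_num q)"
| "prog_num (Comp p q) = 6 + 4 * prod_encode (prog_num p, prog_num q)"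
| "prog_num (PrimRec p q) = 7 + 4 * prod_encode (prog_num p, prog_num q)"
| "prog_num (Mu p) = 8 + 4 * prog_num p"

lemma prog_num_inject: "prog_num p = prog_num q \<longleftrightarrow> p = q"
proof (induction p arbitrary: q)
  case Zero then show ?case by (cases q) auto
next
  case Succ then show ?case by (cases q) auto
next
  case Fst then show ?case by (cases q) auto
next
  case Snd then show ?case by (cases q) auto
next
  case Query then show ?case by (cases q) auto
next
  case (Pr p1 p2) then show ?case by (cases q) (auto, presburger+)
next
  case (Comp p1 p2) then show ?case by (cases q) (auto, presburger+)
next
  case (PrimRec p1 p2) then show ?case by (cases q) (auto, presburger+)
next
  case (Mu p) then show ?case by (cases q) (auto, presburger+)
qed

definition computable_in :: "cantor \<Rightarrow> (nat \<Rightarrow> nat) \<Rightarrow> bool" where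
  "computable_in A f \<longleftrightarrow> (\<exists>p. \<forall>x. run A p x = Some (f x))"

abbreviation empty_oracle :: cantor where
  "empty_oracle \<equiv> (\<lambda>_. False)"

text \<open>The Turing jump \<open>{e. \<Phi>\<^sub>e\<^sup>A(e) converges}\<close>; the halting set is the jump of the empty set.\<close>

definition jump :: "cantor \<Rightarrow> cantor" where
  "jump A e \<longleftrightarrow> (\<exists>p. prog_num p = e \<and> run A p e \<noteq> None)"

definition halting_set :: cantor where
  "halting_set = jump empty_oracle"


section \<open>Computable measures on Cantor space\<close>

definition cyl :: "bool list \<Rightarrow> cantor set" where
  "cyl \<sigma> = {X. \<forall>i<length \<sigma>. X i = \<sigma> ! i}"

definition string_num :: "bool list \<Rightarrow> nat" where
  "string_num \<sigma> = list_encode (map of_bool \<sigma>)"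

text \<open>
  \<open>dyadic n\<close> is the dyadic rational \<open>a / 2 ^ k\<close> (\<open>a\<close> an integer) named by \<open>n\<close>. Every dyadic
  rational has a name, and a function into the dyadic rationals is computable if names of its
  values can be computed.
\<close>

definition dyadic :: "nat \<Rightarrow> real" where
  "dyadic n = (case prod_decode n of (a, k) \<Rightarrow> of_int (int_decode a) / 2 ^ k)"

definition cantor_prob :: "cantor measure \<Rightarrow> bool" where
  "cantor_prob \<mu> \<longleftrightarrow> prob_space \<mu> \<and> sets \<mu> = sets borel"

definition computable_measure :: "cantor measure \<Rightarrow> bool" where
  "computable_measure \<mu> \<longleftrightarrow>
     (\<exists>f. computable_in empty_oracle f \<and>
        (\<forall>\<sigma> i. \<bar>measure \<mu> (cyl \<sigma>) - dyadic (f (prod_encode (string_num \<sigma>, i)))\<bar> \<le> (1 / 2) ^ i))"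

definition Atoms :: "cantor measure \<Rightarrow> cantor set" where
  "Atoms \<mu> = {A. measure \<mu> {A} > 0}"

definition trivial_measure :: "cantor measure \<Rightarrow> bool" where
  "trivial_measure \<mu> \<longleftrightarrow> measure \<mu> (Atoms \<mu>) = 1"


section \<open>Martin-Loef randomness\<close>

text \<open>
  One program with oracle \<open>A\<close> semi-decides, uniformly in \<open>i\<close>, a set of strings whose cylinders
  have union \<open>U i\<close>.
\<close>

definition uniformly_effectively_open :: "cantor \<Rightarrow> (nat \<Rightarrow> cantor set) \<Rightarrow> bool" where
  "uniformly_effectively_open A U \<longleftrightarrow>
     (\<exists>p. \<forall>i. U i = (\<Union>\<sigma>\<in>{\<sigma>. run A p (prod_encode (i, string_num \<sigma>)) \<noteq> None}. cyl \<sigma>))"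

definition martin_loef_test :: "cantor \<Rightarrow> cantor measure \<Rightarrow> (nat \<Rightarrow> cantor set) \<Rightarrow> bool" where
  "martin_loef_test A \<mu> U \<longleftrightarrow>
     uniformly_effectively_open A U \<and> (\<forall>i. measure \<mu> (U i) \<le> (1 / 2) ^ i)"

definition MLR_rel :: "cantor \<Rightarrow> cantor measure \<Rightarrow> cantor set" where
  "MLR_rel A \<mu> = {X. \<forall>U. martin_loef_test A \<mu> U \<longrightarrow> X \<notin> (\<Inter>i. U i)}"

definition MLR :: "cantor measure \<Rightarrow> cantor set" where
  "MLR \<mu> = MLR_rel empty_oracle \<mu>"

definition two_MLR :: "cantor measure \<Rightarrow> cantor set" where
  "two_MLR \<mu> = MLR_rel halting_set \<mu>"

end

theory Submission
  imports Defs
begin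

text \<open>
  Let \<open>\<Omega> \<in> [0, 1)\<close> be the leftmost real outside a universal Martin-Loef test for the uniform measure
  \<open>\<lambda>\<close> on \<open>[0, 1)\<close>. It is the limit of a computable nondecreasing sequence \<open>q\<^sub>t\<close> of dyadic rationals.
  Send a real \<open>z\<close> to the sequence whose bit at \<open>\<langle>n, t\<rangle>\<close> tells whether
  \<open>\<lfloor>2\<^sup>n z\<rfloor> \<le> \<lfloor>2\<^sup>n q\<^sub>t\<rfloor>\<close>, and let \<open>\<mu>\<close> be the image of \<open>\<lambda>\<close>. Finitely many bits
  only depend on finitely many digits of \<open>z\<close>, so \<open>\<mu>\<close> is computable. If \<open>z \<noteq> \<Omega>\<close>, then from some
  point on the comparison is decided once and for all, so the image of \<open>z\<close> is a computable
  sequence; hence \<open>\<mu>\<close> is carried by a countable set and is trivial. The image \<open>X\<close> of \<open>\<Omega>\<close> is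
  \<open>\<mu>\<close>-random because a \<open>\<mu>\<close>-test that captures \<open>X\<close> pulls back to a \<open>\<lambda>\<close>-test that captures \<open>\<Omega>\<close>,
  and \<open>X\<close> is not an atom because it determines \<open>\<Omega>\<close>. Finally \<open>X\<close> is computable from \<open>\<emptyset>'\<close>, like
  every other point of the support of \<open>\<mu>\<close>, and a non-atom computable from \<open>\<emptyset>'\<close> is captured by
  the \<open>\<emptyset>'\<close>-test formed from its own initial segments of small measure.
\<close>

section \<open>Computable functions\<close>

abbreviation p1 :: "nat \<Rightarrow> nat" where "p1 x \<equiv> fst (prod_decode x)"
abbreviation p2 :: "nat \<Rightarrow> nat" where "p2 x \<equiv> snd (prod_decode x)"
abbreviation pair :: "nat \<Rightarrow> nat \<Rightarrow> nat" where "pair x y \<equiv> prod_encode (x, y)"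

definition decidable_in :: "cantor \<Rightarrow> (nat \<Rightarrow> bool) \<Rightarrow> bool" where
  "decidable_in A P \<longleftrightarrow> computable_in A (\<lambda>x. of_bool (P x))"

named_theorems comp_intros

lemma computable_comp:
  assumes "computable_in A f" "computable_in A g"
  shows "computable_in A (\<lambda>x. f (g x))"
proof -
  obtain p q where "\<And>x. run A p x = Some (f x)" "\<And>x. run A q x = Some (g x)"
    using assms unfolding computable_in_def by metis
  then have "\<And>x. run A (Comp p q) x = Some (f (g x))" by simp
  then show ?thesis unfolding computable_in_def by blast
qed

lemma computable_pair [comp_intros]:
  assumes "computable_in A f" "computable_in A g"
  shows "computable_in A (\<lambda>x. pair (f x) (g x))"
proof -
  obtain p q where "\<And>x. run A p x = Some (f x)" "\<And>x. run A q x = Some (g x)"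
    using assms unfolding computable_in_def by metis
  then have "\<And>x. run A (Pr p q) x = Some (pair (f x) (g x))" by simp
  then show ?thesis unfolding computable_in_def by blast
qed

lemma computable_p1 [comp_intros]:
  assumes "computable_in A f" shows "computable_in A (\<lambda>x. p1 (f x))"
proof -
  have "computable_in A p1" unfolding computable_in_def by (rule exI[of _ Fst]) simp
  from computable_comp[OF this assms] show ?thesis .
qed

lemma computable_p2 [comp_intros]:
  assumes "computable_in A f" shows "computable_in A (\<lambda>x. p2 (f x))"
proof -
  have "computable_in A p2" unfolding computable_in_def by (rule exI[of _ Snd]) simp
  from computable_comp[OF this assms] show ?thesis .
qed

lemma computable_id [comp_intros]: "computable_in A (\<lambda>x. x)"
proof -
  have "\<And>x. run A (Pr Fst Snd) x = Some x" by simp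
  then show ?thesis unfolding computable_in_def by blast
qed

lemma computable_Suc [comp_intros]:
  assumes "computable_in A f" shows "computable_in A (\<lambda>x. Suc (f x))"
proof -
  have "computable_in A Suc" unfolding computable_in_def by (rule exI[of _ Succ]) simp
  from computable_comp[OF this assms] show ?thesis .
qed

lemma decidable_query [comp_intros]:
  assumes "computable_in A f" shows "decidable_in A (\<lambda>x. A (f x))"
proof -
  have "computable_in A (\<lambda>x. of_bool (A x))"
    unfolding computable_in_def by (rule exI[of _ Query]) simp
  from computable_comp[OF this assms] show ?thesis unfolding decidable_in_def .
qed

lemma computable_const [comp_intros]: "computable_in A (\<lambda>x. c)"
proof (induction c)
  case 0
  show ?case unfolding computable_in_def by (rule exI[of _ Zero]) simp
next
  case (Suc c)
  then show ?case by (rule computable_Suc)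
qed

text \<open>\<open>PrimRec\<close> carries a parameter along, so with \<open>x\<close> itself as the
  parameter both the start value and the step may depend on \<open>x\<close>. The step reads
  parameter, counter and previous value from one nested pair.\<close>

lemma computable_rec [comp_intros]:
  assumes "computable_in A f"
    and "computable_in A (\<lambda>z. s (p1 z) (p1 (p2 z)) (p2 (p2 z)))"
    and "computable_in A n"
  shows "computable_in A (\<lambda>x. rec_nat (f x) (s x) (n x))"
proof -
  obtain p where p: "\<And>x. run A p x = Some (f x)" using assms unfolding computable_in_def by metis
  obtain q where q: "\<And>z. run A q z = Some (s (p1 z) (p1 (p2 z)) (p2 (p2 z)))"
    using assms unfolding computable_in_def by metis
  have "run A (PrimRec p q) (pair x k) = Some (rec_nat (f x) (s x) k)" for x k
    by (induction k) (auto simp: p q)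
  then have "run A (PrimRec p q) z = Some (rec_nat (f (p1 z)) (s (p1 z)) (p2 z))" for z
    by (metis prod.collapse prod_decode_inverse)
  then have "computable_in A (\<lambda>z. rec_nat (f (p1 z)) (s (p1 z)) (p2 z))"
    unfolding computable_in_def by blast
  from computable_comp[OF this computable_pair[OF computable_id assms(3)]] show ?thesis by simp
qed

lemma computable_add [comp_intros]:
  assumes "computable_in A f" "computable_in A g" shows "computable_in A (\<lambda>x. f x + g x)"
proof -
  have "computable_in A (\<lambda>x. rec_nat (f x) (\<lambda>k y. Suc y) (g x))"
    by (intro comp_intros assms)
  moreover have "rec_nat a (\<lambda>k y. Suc y) b = a + b" for a b by (induction b) auto
  ultimately show ?thesis by simp
qed

lemma computable_mult [comp_intros]:
  assumes "computable_in A f" "computable_in A g" shows "computable_in A (\<lambda>x. f x * g x)"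
proof -
  have "computable_in A (\<lambda>x. rec_nat 0 (\<lambda>k y. y + f x) (g x))"
    by (intro comp_intros assms computable_comp[OF assms(1)])
  moreover have "rec_nat 0 (\<lambda>k y. y + a) b = a * b" for a b :: nat by (induction b) auto
  ultimately show ?thesis by simp
qed

lemma computable_power [comp_intros]:
  assumes "computable_in A f" "computable_in A g" shows "computable_in A (\<lambda>x. f x ^ g x)"
proof -
  have "computable_in A (\<lambda>x. rec_nat 1 (\<lambda>k y. y * f x) (g x))"
    by (intro comp_intros assms computable_comp[OF assms(1)])
  moreover have "rec_nat 1 (\<lambda>k y. y * a) b = a ^ b" for a b :: nat by (induction b) auto
  ultimately show ?thesis by simp
qed

lemma computable_diff [comp_intros]:
  assumes "computable_in A f" "computable_in A g" shows "computable_in A (\<lambda>x. f x - g x)"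
proof -
  \<comment> \<open>Returning the counter of the last step yields the predecessor; iterating the
    predecessor yields truncated subtraction.\<close>
  have 1: "computable_in A (\<lambda>x. rec_nat 0 (\<lambda>k y. k) (h x))" if "computable_in A h" for h
    by (intro comp_intros that)
  have "rec_nat 0 (\<lambda>k y. k) b = b - 1" for b :: nat by (induction b) auto
  with 1 have pred: "computable_in A (\<lambda>x. h x - 1)" if "computable_in A h" for h
    using that by simp
  have "computable_in A (\<lambda>x. rec_nat (f x) (\<lambda>k y. y - 1) (g x))"
    by (intro comp_intros pred assms)
  moreover have "rec_nat a (\<lambda>k y. y - 1) b = a - b" for a b :: nat by (induction b) auto
  ultimately show ?thesis by simp
qed

lemma computable_of_bool [comp_intros]:
  "decidable_in A P \<Longrightarrow> computable_in A (\<lambda>x. of_bool (P x))"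
  by (simp add: decidable_in_def)

lemma decidable_comp:
  "decidable_in A P \<Longrightarrow> computable_in A g \<Longrightarrow> decidable_in A (\<lambda>x. P (g x))"
  unfolding decidable_in_def by (rule computable_comp)

lemma decidable_le [comp_intros]:
  assumes "computable_in A f" "computable_in A g" shows "decidable_in A (\<lambda>x. f x \<le> g x)"
proof -
  have "computable_in A (\<lambda>x. 1 - (f x - g x))" by (intro comp_intros assms)
  moreover have "1 - (a - b) = of_bool (a \<le> b)" for a b :: nat by auto
  ultimately show ?thesis unfolding decidable_in_def by simp
qed

lemma decidable_not [comp_intros]:
  assumes "decidable_in A P" shows "decidable_in A (\<lambda>x. \<not> P x)"
proof -
  have "computable_in A (\<lambda>x. 1 - of_bool (P x))" by (intro comp_intros assms)
  moreover have "1 - of_bool b = (of_bool (\<not> b) :: nat)" for b by auto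
  ultimately show ?thesis unfolding decidable_in_def by (simp only:)
qed

lemma decidable_conj [comp_intros]:
  assumes "decidable_in A P" "decidable_in A Q" shows "decidable_in A (\<lambda>x. P x \<and> Q x)"
  using computable_mult[OF assms[unfolded decidable_in_def]]
  unfolding decidable_in_def by (simp add: of_bool_conj)

lemma decidable_disj [comp_intros]:
  assumes "decidable_in A P" "decidable_in A Q" shows "decidable_in A (\<lambda>x. P x \<or> Q x)"
proof -
  have "decidable_in A (\<lambda>x. \<not> (\<not> P x \<and> \<not> Q x))" by (intro comp_intros assms)
  then show ?thesis by simp
qed

lemma decidable_imp [comp_intros]:
  assumes "decidable_in A P" "decidable_in A Q" shows "decidable_in A (\<lambda>x. P x \<longrightarrow> Q x)"
proof -
  have "decidable_in A (\<lambda>x. \<not> (P x \<and> \<not> Q x))" by (intro comp_intros assms)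
  then show ?thesis by simp
qed

lemma decidable_less [comp_intros]:
  assumes "computable_in A f" "computable_in A g" shows "decidable_in A (\<lambda>x. f x < g x)"
  using decidable_le[OF computable_Suc[OF assms(1)] assms(2)] by (simp add: Suc_le_eq)

lemma decidable_eq [comp_intros]:
  assumes "computable_in A f" "computable_in A g" shows "decidable_in A (\<lambda>x. f x = g x)"
proof -
  have "decidable_in A (\<lambda>x. f x \<le> g x \<and> g x \<le> f x)" by (intro comp_intros assms)
  then show ?thesis by (simp add: eq_iff)
qed

lemma computable_if [comp_intros]:
  assumes "decidable_in A P" "computable_in A f" "computable_in A g"
  shows "computable_in A (\<lambda>x. if P x then f x else g x)"
proof -
  have "computable_in A (\<lambda>x. of_bool (P x) * f x + of_bool (\<not> P x) * g x)"
    by (intro comp_intros assms)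
  moreover have "of_bool b * u + of_bool (\<not> b) * v = (if b then u else v)" for b and u v :: nat
    by auto
  ultimately show ?thesis by (simp only:)
qed

text \<open>Truth values are summed by primitive recursion. Bounded quantifiers and division reduce
  to such counts.\<close>

lemma computable_card [comp_intros]:
  assumes "decidable_in A (\<lambda>z. P (p1 z) (p2 z))" "computable_in A n"
  shows "computable_in A (\<lambda>x. card {k. k < n x \<and> P x k})"
proof -
  have "decidable_in A (\<lambda>z. P (p1 z) (p1 (p2 z)))"
    using decidable_comp[OF assms(1), of "\<lambda>z. pair (p1 z) (p1 (p2 z))"]
    by (simp add: comp_intros)
  then have "computable_in A (\<lambda>x. rec_nat 0 (\<lambda>k y. y + of_bool (P x k)) (n x))"
    by (intro comp_intros assms)
  moreover have "rec_nat 0 (\<lambda>k y. y + of_bool (R k)) m = card {k. k < m \<and> R k}" for R m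
  proof (induction m)
    case (Suc m)
    have "{k. k < Suc m \<and> R k} = {k. k < m \<and> R k} \<union> (if R m then {m} else {})"
      by (auto simp: less_Suc_eq)
    then show ?case using Suc by auto
  qed simp
  ultimately show ?thesis by simp
qed

lemma decidable_bex [comp_intros]:
  assumes "decidable_in A (\<lambda>z. P (p1 z) (p2 z))" "computable_in A n"
  shows "decidable_in A (\<lambda>x. \<exists>k<n x. P x k)"
proof -
  have "decidable_in A (\<lambda>x. 0 < card {k. k < n x \<and> P x k})" by (intro comp_intros assms)
  then show ?thesis by (simp add: card_gt_0_iff)
qed

lemma decidable_ball [comp_intros]:
  assumes "decidable_in A (\<lambda>z. P (p1 z) (p2 z))" "computable_in A n"
  shows "decidable_in A (\<lambda>x. \<forall>k<n x. P x k)"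
proof -
  have "decidable_in A (\<lambda>x. \<not> (\<exists>k<n x. \<not> P x k))" by (intro comp_intros assms)
  then show ?thesis by simp
qed

text \<open>For positive \<open>b\<close>, the quotient \<open>a div b\<close> counts the positive
  multiples of \<open>b\<close> up to \<open>a\<close>.\<close>

lemma computable_div [comp_intros]:
  assumes "computable_in A f" "computable_in A g" shows "computable_in A (\<lambda>x. f x div g x)"
proof -
  have "computable_in A (\<lambda>x. if g x = 0 then 0 else card {k. k < f x \<and> Suc k * g x \<le> f x})"
    by (intro comp_intros assms computable_comp[OF assms(1)] computable_comp[OF assms(2)])
  moreover have "(if b = 0 then 0 else card {k. k < a \<and> Suc k * b \<le> a}) = a div b" for a b :: nat
  proof (cases "b = 0")
    case False
    then have iff: "Suc k * b \<le> a \<longleftrightarrow> k < a div b" for k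
      by (metis Suc_le_eq less_eq_div_iff_mult_less_eq not_gr_zero)
    have "{k. k < a \<and> Suc k * b \<le> a} = {..<a div b}"
      unfolding iff using less_le_trans[OF _ div_le_dividend] by blast
    then show ?thesis using False by simp
  qed simp
  ultimately show ?thesis by simp
qed

lemma computable_mod [comp_intros]:
  assumes "computable_in A f" "computable_in A g" shows "computable_in A (\<lambda>x. f x mod g x)"
  unfolding minus_div_mult_eq_mod[symmetric] by (intro comp_intros assms)

section \<open>Unbounded search and list codes\<close>

lemma run_MuI:
  assumes "run A p (pair x y) = Some 0" "\<And>m. m < y \<Longrightarrow> \<exists>k. run A p (pair x m) = Some (Suc k)"
  shows "run A (Mu p) x = Some y"
proof -
  define found where "found n \<longleftrightarrow> run A p (pair x n) = Some 0 \<and>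
    (\<forall>m<n. \<exists>k. run A p (pair x m) = Some (Suc k))" for n
  have y: "found y" using assms by (auto simp: found_def)
  moreover have "y \<le> n" if "found n" for n
    using that assms(2)[of n] by (auto simp: found_def not_less[symmetric])
  ultimately have "(LEAST n. found n) = y" by (blast intro: Least_equality)
  moreover have "run A (Mu p) x = (if \<exists>n. found n then Some (LEAST n. found n) else None)"
    by (simp only: run.simps Let_def found_def)
  ultimately show ?thesis using y by auto
qed

lemma run_MuD:
  assumes "run A (Mu p) x = Some y"
  shows "run A p (pair x y) = Some 0" "\<And>m. m < y \<Longrightarrow> \<exists>k. run A p (pair x m) = Some (Suc k)"
proof -
  define found where "found n \<longleftrightarrow> run A p (pair x n) = Some 0 \<and>
    (\<forall>m<n. \<exists>k. run A p (pair x m) = Some (Suc k))" for n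
  have "run A (Mu p) x = (if \<exists>n. found n then Some (LEAST n. found n) else None)"
    by (simp only: run.simps Let_def found_def)
  with assms have "found y" by (metis LeastI_ex option.distinct(1) option.inject)
  then show "run A p (pair x y) = Some 0" "\<And>m. m < y \<Longrightarrow> \<exists>k. run A p (pair x m) = Some (Suc k)"
    by (auto simp: found_def)
qed

lemma computable_Least [comp_intros]:
  assumes "decidable_in A (\<lambda>z. P (p1 z) (p2 z))" "\<And>x. \<exists>k. P x k"
  shows "computable_in A (\<lambda>x. LEAST k. P x k)"
proof -
  have "computable_in A (\<lambda>z. of_bool (\<not> P (p1 z) (p2 z)))" by (intro comp_intros assms)
  then obtain p where p: "\<And>z. run A p z = Some (of_bool (\<not> P (p1 z) (p2 z)))"
    unfolding computable_in_def by metis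
  have "run A (Mu p) x = Some (LEAST k. P x k)" for x
  proof (rule run_MuI)
    show "run A p (pair x (LEAST k. P x k)) = Some 0"
      using LeastI_ex[OF assms(2)[of x]] by (simp add: p)
    show "\<exists>k. run A p (pair x m) = Some (Suc k)" if "m < (LEAST k. P x k)" for m
      using not_less_Least[OF that] by (simp add: p)
  qed
  then show ?thesis unfolding computable_in_def by blast
qed

lemma semidecidable:
  assumes "decidable_in A P"
  obtains p where "\<And>x. run A p x \<noteq> None \<longleftrightarrow> P x"
proof -
  \<comment> \<open>The search candidate is discarded: the search stops at \<open>0\<close> if
    \<open>P x\<close> holds and runs forever otherwise.\<close>
  have "computable_in A (\<lambda>z. of_bool (\<not> P (p1 z)))"
    by (intro comp_intros decidable_comp[OF assms])
  then obtain p where p: "\<And>z. run A p z = Some (of_bool (\<not> P (p1 z)))"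
    unfolding computable_in_def by metis
  have "run A (Mu p) x \<noteq> None \<longleftrightarrow> P x" for x by (auto simp: p Let_def)
  then show ?thesis by (rule that)
qed

text \<open>A nonempty list has a code \<open>Suc (pair head tail)\<close>, so the recursion works
  from the end of the list: step \<open>k\<close> prepends entry \<open>n x - Suc k\<close>.\<close>

lemma computable_list_encode:
  assumes "computable_in A (\<lambda>z. h (p1 z) (p2 z))" "computable_in A n"
  shows "computable_in A (\<lambda>x. list_encode (map (h x) [0..<n x]))"
proof -
  have 1: "computable_in A (\<lambda>x. h (f x) (g x))" if "computable_in A f" "computable_in A g" for f g
    using computable_comp[OF assms(1) computable_pair[OF that]] by simp
  have "computable_in A (\<lambda>x. rec_nat 0 (\<lambda>k y. Suc (pair (h x (n x - Suc k)) y)) (n x))"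
    by (intro comp_intros 1 assms computable_comp[OF assms(2)])
  moreover have "rec_nat 0 (\<lambda>k y. Suc (pair (r (m - Suc k)) y)) d = list_encode (map r [m - d..<m])"
    if "d \<le> m" for r m d using that
  proof (induction d)
    case (Suc d)
    have "[m - Suc d..<m] = (m - Suc d) # [m - d..<m]"
      using Suc.prems by (subst upt_conv_Cons) (auto simp: Suc_diff_Suc)
    then show ?case using Suc by simp
  qed simp
  ultimately show ?thesis by simp
qed

section \<open>Certificates of convergence\<close>

text \<open>A certificate is the binary code of a finite set of facts \<open>\<langle>e, x, y\<rangle>\<close>, claiming that
  program number \<open>e\<close> with the empty oracle yields \<open>y\<close> at \<open>x\<close>, in which every fact is justified by
  members of the set.\<close>

definition fact_in :: "nat \<Rightarrow> nat \<Rightarrow> nat \<Rightarrow> nat \<Rightarrow> bool" where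
  "fact_in c e x y \<longleftrightarrow> c div 2 ^ pair e (pair x y) mod 2 = 1"

text \<open>The clauses follow \<open>prog_num\<close>: 0 to 4 are the basic programs, where a query
  answers 0 because the oracle is empty; from 5 on, the residue of \<open>e - 5\<close> modulo 4
  gives the constructor and the quotient codes its components. Witnesses are bounded by
  \<open>c\<close> to keep the predicate decidable.\<close>

definition justified :: "nat \<Rightarrow> nat \<Rightarrow> nat \<Rightarrow> nat \<Rightarrow> bool" where
  "justified c e x y \<longleftrightarrow>
     (e = 0 \<and> y = 0) \<or> (e = 1 \<and> y = Suc x) \<or> (e = 2 \<and> y = p1 x) \<or> (e = 3 \<and> y = p2 x) \<or>
     (e = 4 \<and> y = 0) \<or>
     (5 \<le> e \<and>
       (((e - 5) mod 4 = 0 \<and> fact_in c (p1 ((e - 5) div 4)) x (p1 y) \<and>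
           fact_in c (p2 ((e - 5) div 4)) x (p2 y)) \<or>
        ((e - 5) mod 4 = 1 \<and> (\<exists>z<c. fact_in c (p2 ((e - 5) div 4)) x z \<and>
           fact_in c (p1 ((e - 5) div 4)) z y)) \<or>
        ((e - 5) mod 4 = 2 \<and> p2 x = 0 \<and> fact_in c (p1 ((e - 5) div 4)) (p1 x) y) \<or>
        ((e - 5) mod 4 = 2 \<and> 0 < p2 x \<and> (\<exists>z<c. fact_in c e (pair (p1 x) (p2 x - 1)) z \<and>
           fact_in c (p2 ((e - 5) div 4)) (pair (p1 x) (pair (p2 x - 1) z)) y)) \<or>
        ((e - 5) mod 4 = 3 \<and> fact_in c ((e - 5) div 4) (pair x y) 0 \<and>
           (\<forall>m<y. \<exists>k<c. fact_in c ((e - 5) div 4) (pair x m) (Suc k)))))"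

definition certificate :: "nat \<Rightarrow> bool" where
  "certificate c \<longleftrightarrow>
     (\<forall>t<c. c div 2 ^ t mod 2 = 1 \<longrightarrow> justified c (p1 t) (p1 (p2 t)) (p2 (p2 t)))"

definition halts_by :: "nat \<Rightarrow> nat \<Rightarrow> nat \<Rightarrow> bool" where
  "halts_by e x c \<longleftrightarrow> certificate c \<and> (\<exists>y<c. fact_in c e x y)"

lemma decidable_fact_in [comp_intros]:
  "computable_in A f \<Longrightarrow> computable_in A g \<Longrightarrow> computable_in A h \<Longrightarrow> computable_in A k \<Longrightarrow>
   decidable_in A (\<lambda>x. fact_in (f x) (g x) (h x) (k x))"
  unfolding fact_in_def by (intro comp_intros)

text \<open>Under a bounded quantifier the rules replace \<open>x\<close> by \<open>p1 z\<close>,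
  where the assumptions on \<open>f\<close>, \<open>g\<close>, \<open>h\<close>, \<open>k\<close> do
  not apply directly. So the projections of a single number are treated first, and composition gives
  the general form.\<close>

lemma decidable_justified [comp_intros]:
  assumes "computable_in A f" "computable_in A g" "computable_in A h" "computable_in A k"
  shows "decidable_in A (\<lambda>x. justified (f x) (g x) (h x) (k x))"
proof -
  have "decidable_in A (\<lambda>z. justified (p1 (p1 z)) (p2 (p1 z)) (p1 (p2 z)) (p2 (p2 z)))"
    unfolding justified_def by (intro comp_intros)
  from decidable_comp[OF this, of "\<lambda>x. pair (pair (f x) (g x)) (pair (h x) (k x))"]
  show ?thesis by (simp add: comp_intros assms)
qed

lemma decidable_halts_by [comp_intros]:
  assumes "computable_in A f" "computable_in A g" "computable_in A h"
  shows "decidable_in A (\<lambda>x. halts_by (f x) (g x) (h x))"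
proof -
  have "decidable_in A (\<lambda>z. halts_by (p1 (p1 z)) (p2 (p1 z)) (p2 z))"
    unfolding halts_by_def certificate_def by (intro comp_intros)
  from decidable_comp[OF this, of "\<lambda>x. pair (pair (f x) (g x)) (h x)"]
  show ?thesis by (simp add: comp_intros assms)
qed

lemma fact_in_iff: "fact_in c e x y \<longleftrightarrow> pair e (pair x y) \<in> set_decode c"
  by (simp add: fact_in_def set_decode_def odd_iff_mod_2_eq_one)

lemma set_decode_bound: "t \<in> set_decode c \<Longrightarrow> t < c"
  by (rule ccontr) (use less_le_trans[OF less_exp[of c], of "2 ^ t"] in
      \<open>auto simp: set_decode_def not_less power_increasing\<close>)

text \<open>Members of a set with code \<open>c\<close> lie below \<open>c\<close>, and so do their
  components. Hence the bounds in \<open>justified\<close> and \<open>halts_by\<close> lose no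
  witness.\<close>

lemma fact_in_bound: "fact_in c e x y \<Longrightarrow> y < c"
  unfolding fact_in_iff
  by (meson le_prod_encode_2 le_trans set_decode_bound le_less_trans)

lemma certificate_iff:
  "certificate c \<longleftrightarrow> (\<forall>e x y. fact_in c e x y \<longrightarrow> justified c e x y)"
proof -
  have "certificate c \<longleftrightarrow> (\<forall>t. t \<in> set_decode c \<longrightarrow> justified c (p1 t) (p1 (p2 t)) (p2 (p2 t)))"
    unfolding certificate_def using set_decode_bound[of _ c]
    by (auto simp: set_decode_def odd_iff_mod_2_eq_one)
  also have "\<dots> \<longleftrightarrow> (\<forall>e x y. fact_in c e x y \<longrightarrow> justified c e x y)"
    unfolding fact_in_iff by (metis fst_conv prod.collapse prod_decode_inverse prod_encode_inverse snd_conv)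
  finally show ?thesis .
qed

lemma justified_simps:
  "justified c (prog_num Zero) x y \<longleftrightarrow> y = 0"
  "justified c (prog_num Succ) x y \<longleftrightarrow> y = Suc x"
  "justified c (prog_num Fst) x y \<longleftrightarrow> y = p1 x"
  "justified c (prog_num Snd) x y \<longleftrightarrow> y = p2 x"
  "justified c (prog_num Query) x y \<longleftrightarrow> y = 0"
  "justified c (prog_num (Pr p q)) x y \<longleftrightarrow>
     fact_in c (prog_num p) x (p1 y) \<and> fact_in c (prog_num q) x (p2 y)"
  "justified c (prog_num (Comp p q)) x y \<longleftrightarrow>
     (\<exists>z. fact_in c (prog_num q) x z \<and> fact_in c (prog_num p) z y)"
  "justified c (prog_num (PrimRec p q)) (pair a 0) y \<longleftrightarrow> fact_in c (prog_num p) a y"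
  "justified c (prog_num (PrimRec p q)) (pair a (Suc n)) y \<longleftrightarrow>
     (\<exists>z. fact_in c (prog_num (PrimRec p q)) (pair a n) z \<and>
        fact_in c (prog_num q) (pair a (pair n z)) y)"
  "justified c (prog_num (Mu p)) x y \<longleftrightarrow>
     fact_in c (prog_num p) (pair x y) 0 \<and>
     (\<forall>m<y. \<exists>k. fact_in c (prog_num p) (pair x m) (Suc k))"
proof -
  have s: "5 + 4 * a - 5 = 0 + 4 * a" "6 + 4 * a - 5 = 1 + 4 * a" "7 + 4 * a - 5 = 2 + 4 * a"
    "8 + 4 * a - 5 = 3 + 4 * a" for a :: nat
    by simp_all
  have m: "(5 + 4 * a - 5) mod 4 = 0" "(6 + 4 * a - 5) mod 4 = 1" "(7 + 4 * a - 5) mod 4 = 2"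
    "(8 + 4 * a - 5) mod 4 = 3" "(5 + 4 * a - 5) div 4 = a" "(6 + 4 * a - 5) div 4 = a"
    "(7 + 4 * a - 5) div 4 = a" "(8 + 4 * a - 5) div 4 = a" for a :: nat
    unfolding s mod_mult_self2 div_mult_self2[OF zero_neq_numeral[symmetric]] by simp_all
  show "justified c (prog_num Zero) x y \<longleftrightarrow> y = 0"
    "justified c (prog_num Succ) x y \<longleftrightarrow> y = Suc x"
    "justified c (prog_num Fst) x y \<longleftrightarrow> y = p1 x"
    "justified c (prog_num Snd) x y \<longleftrightarrow> y = p2 x"
    "justified c (prog_num Query) x y \<longleftrightarrow> y = 0"
    by (auto simp: justified_def)
  show "justified c (prog_num (Pr p q)) x y \<longleftrightarrow>
     fact_in c (prog_num p) x (p1 y) \<and> fact_in c (prog_num q) x (p2 y)"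
    unfolding justified_def prog_num.simps m by simp
  show "justified c (prog_num (Comp p q)) x y \<longleftrightarrow>
     (\<exists>z. fact_in c (prog_num q) x z \<and> fact_in c (prog_num p) z y)"
    unfolding justified_def prog_num.simps m using fact_in_bound by (simp, blast)
  show "justified c (prog_num (PrimRec p q)) (pair a 0) y \<longleftrightarrow> fact_in c (prog_num p) a y"
    unfolding justified_def prog_num.simps m by simp
  show "justified c (prog_num (PrimRec p q)) (pair a (Suc n)) y \<longleftrightarrow>
     (\<exists>z. fact_in c (prog_num (PrimRec p q)) (pair a n) z \<and>
        fact_in c (prog_num q) (pair a (pair n z)) y)"
    unfolding justified_def prog_num.simps m using fact_in_bound by (simp, blast)
  show "justified c (prog_num (Mu p)) x y \<longleftrightarrow>
     fact_in c (prog_num p) (pair x y) 0 \<and>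
     (\<forall>m<y. \<exists>k. fact_in c (prog_num p) (pair x m) (Suc k))"
    unfolding justified_def prog_num.simps m using fact_in_bound
    by simp (meson Suc_lessD)
qed

lemma run_PrimRec_0: "run A (PrimRec p q) (pair a 0) = run A p a"
  by simp

lemma run_PrimRec_Suc:
  "run A (PrimRec p q) (pair a (Suc n)) =
     Option.bind (run A (PrimRec p q) (pair a n)) (\<lambda>z. run A q (pair a (pair n z)))"
  by simp

text \<open>No order on the facts is needed, because the justification of a fact only refers to
  subprograms or, for a primitive recursion, to a smaller recursion argument.\<close>

lemma certificate_sound:
  assumes "certificate c" "fact_in c (prog_num p) x y"
  shows "run empty_oracle p x = Some y"
  using assms(2)
proof (induction p arbitrary: x y)
  case (Pr p q)
  then have "justified c (prog_num (Pr p q)) x y" using assms(1) certificate_iff by blast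
  then have "fact_in c (prog_num p) x (p1 y)" "fact_in c (prog_num q) x (p2 y)"
    by (auto simp only: justified_simps)
  then show ?case using Pr.IH by simp
next
  case (Comp p q)
  then have "justified c (prog_num (Comp p q)) x y" using assms(1) certificate_iff by blast
  then obtain z where "fact_in c (prog_num q) x z" "fact_in c (prog_num p) z y"
    by (auto simp only: justified_simps)
  then show ?case using Comp.IH by simp
next
  case (PrimRec p q)
  have "run empty_oracle (PrimRec p q) (pair a n) = Some y"
    if "fact_in c (prog_num (PrimRec p q)) (pair a n) y" for a n y
    using that
  proof (induction n arbitrary: y)
    case 0
    then have "fact_in c (prog_num p) a y" using assms(1) certificate_iff justified_simps(8) by blast
    then show ?case using PrimRec.IH by simp
  next
    case (Suc n)
    then have "justified c (prog_num (PrimRec p q)) (pair a (Suc n)) y"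
      using assms(1) certificate_iff by blast
    then obtain z where "fact_in c (prog_num (PrimRec p q)) (pair a n) z"
        "fact_in c (prog_num q) (pair a (pair n z)) y"
      by (auto simp only: justified_simps)
    then show ?case unfolding run_PrimRec_Suc using PrimRec.IH Suc.IH by simp
  qed
  then show ?case using PrimRec.prems by (metis prod.collapse prod_decode_inverse)
next
  case (Mu p)
  then have "justified c (prog_num (Mu p)) x y" using assms(1) certificate_iff by blast
  then have "fact_in c (prog_num p) (pair x y) 0"
      "\<forall>m<y. \<exists>k. fact_in c (prog_num p) (pair x m) (Suc k)"
    by (auto simp only: justified_simps)
  then show ?case by (intro run_MuI) (use Mu.IH in blast)+
next
  case Zero
  then have "justified c (prog_num Zero) x y" using assms(1) certificate_iff by blast
  then show ?case by (simp only: justified_simps run.simps)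
next
  case Succ
  then have "justified c (prog_num Succ) x y" using assms(1) certificate_iff by blast
  then show ?case by (simp only: justified_simps run.simps)
next
  case Fst
  then have "justified c (prog_num Fst) x y" using assms(1) certificate_iff by blast
  then show ?case by (simp only: justified_simps run.simps)
next
  case Snd
  then have "justified c (prog_num Snd) x y" using assms(1) certificate_iff by blast
  then show ?case by (simp only: justified_simps run.simps)
next
  case Query
  then have "justified c (prog_num Query) x y" using assms(1) certificate_iff by blast
  then show ?case by (simp only: justified_simps run.simps if_False)
qed

text \<open>Facts occur only positively in a justification, so it survives enlarging the set;
  \<open>fact_in_bound\<close> restores the bounds on witnesses.\<close>

lemma justified_mono:
  assumes "set_decode c \<subseteq> set_decode d" "justified c e x y"
  shows "justified d e x y"
proof -
  have f: "fact_in c a b z \<Longrightarrow> fact_in d a b z" for a b z using assms(1) by (auto simp: fact_in_iff)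
  have e: "\<exists>z<c. fact_in c a b z \<and> P z \<Longrightarrow> (\<And>z. P z \<Longrightarrow> Q z) \<Longrightarrow> \<exists>z<d. fact_in d a b z \<and> Q z"
    for a b P Q
    using f fact_in_bound by blast
  have s: "\<exists>k<c. fact_in c a b (Suc k) \<Longrightarrow> \<exists>k<d. fact_in d a b (Suc k)" for a b
    using f fact_in_bound Suc_lessD by blast
  show ?thesis
    using assms(2) unfolding justified_def by (elim disjE conjE) (auto intro: f s elim!: e)
qed

lemma certificate_union:
  assumes "finite C" "\<And>c. c \<in> C \<Longrightarrow> certificate c"
  obtains d where "certificate d" "\<And>c e x y. c \<in> C \<Longrightarrow> fact_in c e x y \<Longrightarrow> fact_in d e x y"
proof -
  define d where "d = set_encode (\<Union>c\<in>C. set_decode c)"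
  have d: "set_decode d = (\<Union>c\<in>C. set_decode c)"
    unfolding d_def using assms(1) by (intro set_encode_inverse) auto
  show ?thesis
  proof
    show "certificate d"
      unfolding certificate_iff
    proof (intro allI impI)
      fix e x y assume "fact_in d e x y"
      then obtain c where "c \<in> C" "fact_in c e x y" by (auto simp: fact_in_iff d)
      then have "justified c e x y" using assms(2) certificate_iff by blast
      then show "justified d e x y" by (rule justified_mono[rotated]) (use \<open>c \<in> C\<close> d in auto)
    qed
  qed (auto simp: fact_in_iff d)
qed

lemma certificate_insert:
  assumes "certificate c" "justified c e x y"
  obtains d where "certificate d" "fact_in d e x y"
proof -
  define d where "d = set_encode (insert (pair e (pair x y)) (set_decode c))"
  have d: "set_decode d = insert (pair e (pair x y)) (set_decode c)"
    unfolding d_def by (intro set_encode_inverse) auto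
  show ?thesis
  proof
    show "certificate d"
      unfolding certificate_iff
    proof (intro allI impI)
      fix e' x' y' assume "fact_in d e' x' y'"
      then have "justified c e' x' y'" using assms by (auto simp: fact_in_iff d certificate_iff)
      then show "justified d e' x' y'" by (rule justified_mono[rotated]) (auto simp: d)
    qed
  qed (auto simp: fact_in_iff d)
qed

lemma certificate_0: "certificate 0"
  by (simp add: certificate_def)

lemma certificate_union2:
  assumes "certificate c" "certificate c'"
  obtains d where "certificate d" "\<And>e x y. fact_in c e x y \<Longrightarrow> fact_in d e x y"
    "\<And>e x y. fact_in c' e x y \<Longrightarrow> fact_in d e x y"
  using certificate_union[of "{c, c'}"] assms by (metis finite.simps insert_iff singletonD)

text \<open>Certificates of the subcomputations are merged and the new fact is inserted. Recursion
  needs an inner induction on its argument; search merges the certificates of all candidates up to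
  the answer.\<close>

lemma certificate_complete:
  assumes "run empty_oracle p x = Some y"
  shows "\<exists>c. certificate c \<and> fact_in c (prog_num p) x y"
  using assms
proof (induction p arbitrary: x y)
  case (Pr p q)
  from Pr.prems obtain u v where uv: "run empty_oracle p x = Some u" "run empty_oracle q x = Some v"
    "y = pair u v" by (auto simp: bind_eq_Some_conv)
  obtain c c' where "certificate c" "fact_in c (prog_num p) x u"
    "certificate c'" "fact_in c' (prog_num q) x v" using Pr.IH uv by meson
  then obtain d where "certificate d" "fact_in d (prog_num p) x u" "fact_in d (prog_num q) x v"
    using certificate_union2 by metis
  then have "certificate d" "justified d (prog_num (Pr p q)) x y"
    unfolding justified_simps by (auto simp: uv)
  then show ?case using certificate_insert by metis
next
  case (Comp p q)
  from Comp.prems obtain z where z: "run empty_oracle q x = Some z" "run empty_oracle p z = Some y"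
    by (auto simp: bind_eq_Some_conv)
  obtain c c' where "certificate c" "fact_in c (prog_num q) x z"
    "certificate c'" "fact_in c' (prog_num p) z y" using Comp.IH z by meson
  then obtain d where "certificate d" "fact_in d (prog_num q) x z" "fact_in d (prog_num p) z y"
    using certificate_union2 by metis
  then have "certificate d" "justified d (prog_num (Comp p q)) x y"
    unfolding justified_simps by auto
  then show ?case using certificate_insert by metis
next
  case (PrimRec p q)
  have "\<exists>c. certificate c \<and> fact_in c (prog_num (PrimRec p q)) (pair a n) y"
    if "run empty_oracle (PrimRec p q) (pair a n) = Some y" for a n y
    using that
  proof (induction n arbitrary: y)
    case 0
    then obtain c where "certificate c" "fact_in c (prog_num p) a y"
      using PrimRec.IH unfolding run_PrimRec_0 by meson
    then have "certificate c" "justified c (prog_num (PrimRec p q)) (pair a 0) y"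
      unfolding justified_simps by auto
    then show ?case using certificate_insert by metis
  next
    case (Suc n)
    then obtain z where z: "run empty_oracle (PrimRec p q) (pair a n) = Some z"
      "run empty_oracle q (pair a (pair n z)) = Some y"
      unfolding run_PrimRec_Suc by (auto simp only: bind_eq_Some_conv)
    obtain c c' where "certificate c" "fact_in c (prog_num (PrimRec p q)) (pair a n) z"
      "certificate c'" "fact_in c' (prog_num q) (pair a (pair n z)) y"
      using PrimRec.IH(2)[OF z(2)] Suc.IH[OF z(1)] by meson
    then obtain d where "certificate d" "fact_in d (prog_num (PrimRec p q)) (pair a n) z"
      "fact_in d (prog_num q) (pair a (pair n z)) y"
      using certificate_union2 by metis
    then have "certificate d" "justified d (prog_num (PrimRec p q)) (pair a (Suc n)) y"
      unfolding justified_simps by auto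
    then show ?case using certificate_insert by metis
  qed
  then show ?case using PrimRec.prems by (metis prod.collapse prod_decode_inverse)
next
  case (Mu p)
  note M = run_MuD[OF Mu.prems]
  define R where "R m = (if m = y then 0 else the (run empty_oracle p (pair x m)))" for m
  have "run empty_oracle p (pair x m) = Some (R m)" if "m \<le> y" for m
    using M(1) M(2)[of m] that by (auto simp: R_def le_less)
  then have "\<forall>m\<in>{..y}. \<exists>c. certificate c \<and> fact_in c (prog_num p) (pair x m) (R m)"
    using Mu.IH by simp
  then obtain C where C: "\<And>m. m \<le> y \<Longrightarrow> certificate (C m) \<and> fact_in (C m) (prog_num p) (pair x m) (R m)"
    unfolding bchoice_iff by auto
  obtain d where d: "certificate d"
    and in_d: "\<And>c e x z. c \<in> C ` {..y} \<Longrightarrow> fact_in c e x z \<Longrightarrow> fact_in d e x z"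
    by (rule certificate_union[of "C ` {..y}"]) (use C in auto)
  have R: "fact_in d (prog_num p) (pair x m) (R m)" if "m \<le> y" for m
    using in_d[of "C m"] C[OF that] that by blast
  have "R y = 0" "\<And>m. m < y \<Longrightarrow> \<exists>k. R m = Suc k"
    by (auto simp: R_def dest!: M(2))
  then have "justified d (prog_num (Mu p)) x y"
    unfolding justified_simps using R by (metis order_refl less_imp_le)
  then show ?case using d certificate_insert by metis
next
  case Zero
  then have "justified 0 (prog_num Zero) x y" unfolding justified_simps by simp
  then show ?case using certificate_0 certificate_insert by metis
next
  case Succ
  then have "justified 0 (prog_num Succ) x y" unfolding justified_simps by simp
  then show ?case using certificate_0 certificate_insert by metis
next
  case Fst
  then have "justified 0 (prog_num Fst) x y" unfolding justified_simps by simp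
  then show ?case using certificate_0 certificate_insert by metis
next
  case Snd
  then have "justified 0 (prog_num Snd) x y" unfolding justified_simps by simp
  then show ?case using certificate_0 certificate_insert by metis
next
  case Query
  then have "justified 0 (prog_num Query) x y" unfolding justified_simps by simp
  then show ?case using certificate_0 certificate_insert by metis
qed

text \<open>This replaces a universal program: convergence becomes an unbounded search over a
  predicate decidable uniformly in the program number.\<close>

lemma halts_by_iff: "(\<exists>c. halts_by (prog_num p) x c) \<longleftrightarrow> run empty_oracle p x \<noteq> None"
  unfolding halts_by_def
  using certificate_sound certificate_complete fact_in_bound
  by (metis not_None_eq)

section \<open>The halting set\<close>

primrec const_prog :: "nat \<Rightarrow> prog" where
  "const_prog 0 = Zero"
| "const_prog (Suc n) = Comp Succ (const_prog n)"

lemma run_const_prog: "run A (const_prog n) x = Some n"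
  by (induction n) auto

text \<open>The number \<open>e x\<close> of a program that ignores its input and searches for a
  witness for \<open>x\<close> is computable from \<open>x\<close>. Run on its own number, that
  program converges exactly if a witness exists.\<close>

lemma halting_set_decides:
  assumes "decidable_in empty_oracle (\<lambda>z. P (p1 z) (p2 z))"
  shows "decidable_in halting_set (\<lambda>x. \<exists>k. P x k)"
proof -
  have "computable_in empty_oracle (\<lambda>z. of_bool (\<not> P (p1 z) (p2 z)))"
    by (intro comp_intros assms)
  then obtain p where p: "\<And>z. run empty_oracle p z = Some (of_bool (\<not> P (p1 z) (p2 z)))"
    unfolding computable_in_def by metis
  have mu: "run empty_oracle (Mu p) x \<noteq> None \<longleftrightarrow> (\<exists>k. P x k)" for x
  proof
    assume "run empty_oracle (Mu p) x \<noteq> None"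
    then obtain y where "run empty_oracle (Mu p) x = Some y" by auto
    from run_MuD(1)[OF this] show "\<exists>k. P x k" by (auto simp: p)
  next
    assume ex: "\<exists>k. P x k"
    have "run empty_oracle (Mu p) x = Some (LEAST k. P x k)"
    proof (rule run_MuI)
      show "run empty_oracle p (pair x (LEAST k. P x k)) = Some 0"
        using LeastI_ex[OF ex] by (simp add: p)
      show "\<exists>k. run empty_oracle p (pair x m) = Some (Suc k)" if "m < (LEAST k. P x k)" for m
        using not_less_Least[OF that] by (simp add: p)
    qed
    then show "run empty_oracle (Mu p) x \<noteq> None" by simp
  qed
  define e where "e x = prog_num (Comp (Mu p) (const_prog x))" for x
  have num: "prog_num (const_prog x) = rec_nat 0 (\<lambda>k y. 6 + 4 * pair 1 y) x" for x
    by (induction x) auto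
  have e: "computable_in A e" for A
    unfolding e_def prog_num.simps num by (intro comp_intros)
  have "halting_set (e x) \<longleftrightarrow> (\<exists>k. P x k)" for x
  proof -
    have "halting_set (e x) \<longleftrightarrow> run empty_oracle (Comp (Mu p) (const_prog x)) (e x) \<noteq> None"
      by (simp only: halting_set_def jump_def e_def prog_num_inject simp_thms)
    also have "\<dots> \<longleftrightarrow> run empty_oracle (Mu p) x \<noteq> None"
      by (simp only: run.simps(7) run_const_prog Option.bind.simps)
    finally show ?thesis by (simp only: mu)
  qed
  then show ?thesis using decidable_query[OF e[of halting_set]] by simp
qed

section \<open>The uniform measure on the unit interval\<close>

definition lam :: "real measure" where
  "lam = uniform_measure lborel {0..<1}"

text \<open>For \<open>z\<close> in \<open>[0, 1)\<close> this is the index of the dyadic interval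
  of length \<open>1 / 2 ^ n\<close> that contains \<open>z\<close>.\<close>

definition digit :: "nat \<Rightarrow> real \<Rightarrow> nat" where
  "digit n z = nat \<lfloor>2 ^ n * z\<rfloor>"

lemma sets_lam [simp, measurable_cong]: "sets lam = sets borel"
  by (simp add: lam_def)

lemma space_lam [simp]: "space lam = UNIV"
  by (simp add: lam_def)

lemma prob_space_lam: "prob_space lam"
  unfolding lam_def by (rule prob_space_uniform_measure) simp_all

interpretation lam: prob_space lam
  by (rule prob_space_lam)

lemma measurable_digit [measurable]: "digit n \<in> lam \<rightarrow>\<^sub>M count_space UNIV"
  unfolding digit_def[abs_def] by measurable

lemma digit_div:
  assumes "n \<le> m"
  shows "digit m z div 2 ^ (m - n) = digit n z"
proof -
  obtain d where m: "m = n + d" using assms le_Suc_ex by blast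
  have "\<lfloor>2 ^ n * z\<rfloor> = \<lfloor>2 ^ m * z\<rfloor> div 2 ^ d"
    using floor_divide_real_eq_div[of "2 ^ d" "2 ^ m * z"] by (simp add: m power_add)
  then show ?thesis
    unfolding digit_def by (simp add: m nat_div_distrib' nat_power_eq)
qed

text \<open>Within \<open>[0, 1)\<close> the indices below \<open>2 ^ n\<close> partition the space
  into intervals of equal length, so measuring reduces to counting, which is computable.\<close>

lemma measure_digit: "measure lam {z. digit n z \<in> S} = card {k. k < 2 ^ n \<and> k \<in> S} / 2 ^ n"
proof -
  define K where "K = {k. k < 2 ^ n \<and> k \<in> S}"
  have fin: "finite K" unfolding K_def by simp
  define J :: "nat \<Rightarrow> real set" where "J k = {k / 2 ^ n..<(k + 1) / 2 ^ n}" for k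
  have digit_eq: "digit n z = k \<longleftrightarrow> z \<in> J k" if "0 \<le> z" for z k
  proof -
    have "digit n z = k \<longleftrightarrow> \<lfloor>2 ^ n * z\<rfloor> = int k" using that by (auto simp: digit_def)
    also have "\<dots> \<longleftrightarrow> z \<in> J k" by (simp add: floor_eq_iff J_def field_simps)
    finally show ?thesis .
  qed
  have emJ: "emeasure lborel (J k) = ennreal (1 / 2 ^ n)" for k
    unfolding J_def by (subst emeasure_lborel_Ico) (auto simp: divide_right_mono diff_divide_distrib[symmetric])
  have "{0..<1} \<inter> {z. digit n z \<in> S} = (\<Union>k\<in>K. J k)"
  proof (intro subset_antisym subsetI)
    fix z assume z: "z \<in> {0..<1} \<inter> {z. digit n z \<in> S}"
    then have "\<lfloor>2 ^ n * z\<rfloor> < 2 ^ n" by (simp add: floor_less_iff)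
    then have "digit n z < 2 ^ n" unfolding digit_def by (simp add: nat_less_iff nat_power_eq)
    then show "z \<in> (\<Union>k\<in>K. J k)" using z digit_eq by (auto simp: K_def)
  next
    fix z assume "z \<in> (\<Union>k\<in>K. J k)"
    then obtain k where k: "k < 2 ^ n" "k \<in> S" "z \<in> J k" by (auto simp: K_def)
    have "0 \<le> z" using k(3) by (auto simp: J_def intro: order_trans[rotated])
    moreover have "real k + 1 \<le> 2 ^ n" using k(1)
      by (metis Suc_eq_plus1 Suc_leI of_nat_1 of_nat_add of_nat_le_iff of_nat_numeral of_nat_power)
    then have "(real k + 1) / 2 ^ n \<le> 1" by (simp only: divide_le_eq_1) simp
    then have "z < 1" by (rule less_le_trans[rotated]) (use k(3) in \<open>simp add: J_def\<close>)
    moreover have "digit n z = k" using digit_eq \<open>0 \<le> z\<close> k(3) by blast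
    ultimately show "z \<in> {0..<1} \<inter> {z. digit n z \<in> S}" using k(2) by simp
  qed
  moreover have "measure lborel (\<Union>k\<in>K. J k) = (\<Sum>k\<in>K. measure lborel (J k))"
  proof (rule measure_finite_Union[OF fin])
    show "disjoint_family_on J K"
      unfolding disjoint_family_on_def
    proof (intro ballI impI)
      fix k l :: nat assume "k \<noteq> l"
      have "0 \<le> z" if "z \<in> J k" for z and k :: nat using that by (auto simp: J_def intro: order_trans[rotated])
      then show "J k \<inter> J l = {}" using digit_eq \<open>k \<noteq> l\<close> by (metis disjoint_iff)
    qed
  qed (auto simp: emJ, simp add: J_def)
  moreover have "measure lborel (J k) = 1 / 2 ^ n" for k
    by (simp add: measure_def emJ)
  moreover have "measure lam {z. digit n z \<in> S} = measure lborel ({0..<1} \<inter> {z. digit n z \<in> S})"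
  proof -
    have "{z. digit n z \<in> S} \<in> sets borel"
      using measurable_sets[OF measurable_digit, of S n] by (simp add: vimage_def)
    then show ?thesis unfolding lam_def by (simp add: measure_uniform_measure)
  qed
  ultimately show ?thesis by (simp add: K_def)
qed

section \<open>The leftmost random real\<close>

text \<open>Program number \<open>e\<close> is read as a test that enumerates, at level \<open>e + 2\<close>, dyadic intervals
  \<open>[j / 2\<^sup>m, (j + 1) / 2\<^sup>m)\<close>. What it has enumerated by stage \<open>t\<close> is forbidden only while its
  measure respects the bound of that level, so that all forbidden intervals together have measure
  less than \<open>1\<close>. In \<open>covered\<close>, \<open>admissible\<close> and \<open>bad\<close>, the number \<open>k\<close> stands for the interval
  \<open>[k / 2\<^sup>t, (k + 1) / 2\<^sup>t)\<close>.\<close>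

definition enum :: "nat \<Rightarrow> nat \<Rightarrow> nat \<Rightarrow> nat \<Rightarrow> bool" where
  "enum e t m j \<longleftrightarrow> (\<exists>c<t. halts_by e (pair (e + 2) (pair m j)) c)"

definition covered :: "nat \<Rightarrow> nat \<Rightarrow> nat \<Rightarrow> bool" where
  "covered e t k \<longleftrightarrow> (\<exists>m<Suc t. enum e t m (k div 2 ^ (t - m)))"

definition admissible :: "nat \<Rightarrow> nat \<Rightarrow> bool" where
  "admissible e t \<longleftrightarrow> card {k. k < 2 ^ t \<and> covered e t k} * 2 ^ (e + 2) \<le> 2 ^ t"

definition bad :: "nat \<Rightarrow> nat \<Rightarrow> bool" where
  "bad t k \<longleftrightarrow> (\<exists>e<t. \<exists>s<Suc t. admissible e s \<and> covered e s (k div 2 ^ (t - s)))"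

definition leftmost :: "nat \<Rightarrow> nat" where
  "leftmost t = (LEAST k. \<not> bad t k)"

text \<open>\<open>approx n t\<close> is \<open>\<lfloor>2\<^sup>n q\<^sub>t\<rfloor>\<close> for \<open>q\<^sub>t = leftmost t / 2\<^sup>t\<close>, and \<open>omega n\<close> is
  its limit \<open>\<lfloor>2\<^sup>n \<Omega>\<rfloor>\<close>.\<close>

definition approx :: "nat \<Rightarrow> nat \<Rightarrow> nat" where
  "approx n t = leftmost t * 2 ^ n div 2 ^ t"

definition omega :: "nat \<Rightarrow> nat" where
  "omega n = Max (range (approx n))"

lemma covered_digit: "covered e s (digit s z) \<longleftrightarrow> (\<exists>m\<le>s. enum e s m (digit m z))"
  unfolding covered_def by (auto simp: digit_div less_Suc_eq_le)

lemma covered_mono: "s \<le> t \<Longrightarrow> covered e s (digit s z) \<Longrightarrow> covered e t (digit t z)"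
  unfolding covered_digit enum_def by (meson le_trans less_le_trans)

lemma measurable_covered [measurable]: "{z. covered e s (digit s z)} \<in> sets lam"
  using measurable_sets[OF measurable_digit, of "{k. covered e s k}" s] by (simp add: vimage_def)

lemma admissible_iff: "admissible e t \<longleftrightarrow> measure lam {z. covered e t (digit t z)} \<le> (1 / 2) ^ (e + 2)"
proof -
  have "admissible e t \<longleftrightarrow>
    real (card {k. k < 2 ^ t \<and> covered e t k} * 2 ^ (e + 2)) \<le> real (2 ^ t)"
    unfolding admissible_def of_nat_le_iff ..
  also have "\<dots> \<longleftrightarrow> measure lam {z. digit t z \<in> {k. covered e t k}} \<le> (1 / 2) ^ (e + 2)"
    unfolding measure_digit by (simp add: field_simps)
  finally show ?thesis by simp
qed

text \<open>For fixed \<open>e\<close> the covered sets grow with the stage, so those of all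
  admissible stages up to \<open>t\<close> lie in the last one, of measure at most
  \<open>(1 / 2) ^ (e + 2)\<close>. Summing over \<open>e\<close> gives less than 1.\<close>

lemma ex_not_bad: "\<exists>k<2 ^ t. \<not> bad t k"
proof (rule ccontr)
  assume "\<not> (\<exists>k<2 ^ t. \<not> bad t k)"
  then have "{k. k < 2 ^ t \<and> bad t k} = {..<2 ^ t}" by auto
  then have 1: "measure lam {z. bad t (digit t z)} = 1"
    using measure_digit[of t "{k. bad t k}"] by simp
  define B where "B e = {z. \<exists>s\<le>t. admissible e s \<and> covered e s (digit s z)}" for e
  have B: "B e \<in> sets lam \<and> measure lam (B e) \<le> (1 / 2) ^ (e + 2)" for e
  proof (cases "\<exists>s\<le>t. admissible e s")
    case True
    define s where "s = Max {s. s \<le> t \<and> admissible e s}"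
    have fin: "finite {s. s \<le> t \<and> admissible e s}" by simp
    have s: "s \<le> t" "admissible e s" using Max_in[OF fin] True unfolding s_def by auto
    have "s' \<le> s" if "s' \<le> t" "admissible e s'" for s'
      using Max_ge[OF fin] that unfolding s_def by blast
    then have "B e = {z. covered e s (digit s z)}"
      unfolding B_def using s covered_mono by blast
    then show ?thesis using s admissible_iff by simp
  next
    case False
    then have "B e = {}" unfolding B_def by auto
    then show ?thesis by simp
  qed
  have "{z. bad t (digit t z)} \<subseteq> (\<Union>e<t. B e)"
    unfolding bad_def B_def by (fastforce simp: digit_div less_Suc_eq_le)
  then have "measure lam {z. bad t (digit t z)} \<le> measure lam (\<Union>e<t. B e)"
    by (rule lam.finite_measure_mono) (use B in auto)
  also have "\<dots> \<le> (\<Sum>e<t. measure lam (B e))"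
    by (rule lam.finite_measure_subadditive_finite) (use B in auto)
  also have "\<dots> \<le> (\<Sum>e<t. (1 / 2) ^ (e + 2))" by (rule sum_mono) (use B in blast)
  also have "\<dots> < 1"
  proof -
    have "(\<Sum>e<t. (1 / 2) ^ (e + 2)) = 1 / 2 - (1 / 2 :: real) ^ (t + 1)"
      by (induction t) (auto simp: field_simps)
    also have "\<dots> < 1" by (simp add: add_pos_pos less_add_same_cancel1 diff_less_eq)
    finally show ?thesis .
  qed
  finally show False using 1 by simp
qed

lemma leftmost_not_bad: "\<not> bad t (leftmost t)"
  unfolding leftmost_def using ex_not_bad[of t] by (metis LeastI_ex)

lemma leftmost_less: "leftmost t < 2 ^ t"
  unfolding leftmost_def using ex_not_bad[of t] by (meson Least_le le_less_trans)

lemma bad_Suc: "bad t (k div 2) \<Longrightarrow> bad (Suc t) k"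
proof -
  assume "bad t (k div 2)"
  then obtain e s where "e < t" "s \<le> t" "admissible e s" "covered e s (k div 2 div 2 ^ (t - s))"
    by (auto simp: bad_def less_Suc_eq_le)
  moreover have "k div 2 div 2 ^ (t - s) = k div 2 ^ (Suc t - s)"
    using \<open>s \<le> t\<close> by (simp add: div_mult2_eq[symmetric] Suc_diff_le)
  ultimately show ?thesis unfolding bad_def by (intro exI[of _ e] exI[of _ s] conjI) auto
qed

text \<open>Both halves of a bad interval stay bad, so the left endpoints
  \<open>leftmost t / 2 ^ t\<close> never move left.\<close>

lemma leftmost_Suc: "2 * leftmost t \<le> leftmost (Suc t)"
proof -
  have "\<not> bad t (leftmost (Suc t) div 2)" using bad_Suc leftmost_not_bad by blast
  then have "leftmost t \<le> leftmost (Suc t) div 2" unfolding leftmost_def[of t] by (rule Least_le)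
  then show ?thesis by linarith
qed

lemma approx_div:
  assumes "n \<le> m" shows "approx m t div 2 ^ (m - n) = approx n t"
proof -
  have "approx m t div 2 ^ (m - n) = leftmost t * 2 ^ n * 2 ^ (m - n) div (2 ^ t * 2 ^ (m - n))"
    unfolding approx_def div_mult2_eq
    using assms by (simp add: div_mult2_eq[symmetric] mult.assoc power_add[symmetric])
  then show ?thesis unfolding approx_def by simp
qed

lemma approx_mono: "s \<le> t \<Longrightarrow> approx n s \<le> approx n t"
proof (induction rule: dec_induct)
  case (step t)
  have "approx n t = 2 * leftmost t * 2 ^ n div 2 ^ Suc t"
    unfolding approx_def by (simp add: mult.assoc)
  also have "\<dots> \<le> approx n (Suc t)"
    unfolding approx_def using leftmost_Suc by (intro div_le_mono mult_right_mono) auto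
  finally show ?case using step by simp
qed simp

lemma approx_less: "approx n t < 2 ^ n"
  unfolding approx_def using leftmost_less[of t] by (simp add: less_mult_imp_div_less mult.commute)

lemma finite_range_approx: "finite (range (approx n))"
  by (rule finite_subset[of _ "{..<2 ^ n}"]) (use approx_less in auto)

lemma approx_le_omega: "approx n t \<le> omega n"
  unfolding omega_def by (rule Max_ge[OF finite_range_approx]) simp

lemma approx_eq_omega: obtains t where "\<And>s. t \<le> s \<Longrightarrow> approx n s = omega n"
proof -
  have "omega n \<in> range (approx n)" unfolding omega_def by (rule Max_in[OF finite_range_approx]) simp
  then obtain t where "omega n = approx n t" by auto
  then show ?thesis using that approx_mono approx_le_omega by (metis le_antisym)
qed

lemma omega_div: assumes "n \<le> m" shows "omega m div 2 ^ (m - n) = omega n"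
proof -
  obtain t where "\<And>s. t \<le> s \<Longrightarrow> approx n s = omega n" using approx_eq_omega by blast
  moreover obtain t' where "\<And>s. t' \<le> s \<Longrightarrow> approx m s = omega m" using approx_eq_omega by blast
  ultimately have "approx n (max t t') = omega n" "approx m (max t t') = omega m" by auto
  then show ?thesis using approx_div[OF assms, of "max t t'"] by simp
qed

text \<open>The measure bound makes every stage of the test admissible. If the test enumerated an
  interval around \<Omega>, some late \<open>leftmost t\<close> would lie in that interval and be
  bad. The level is tied to the program's own number, so one test of each program suffices.\<close>

lemma omega_random:
  fixes p
  defines "e \<equiv> prog_num p"
  defines "W \<equiv> {z. \<exists>m. run empty_oracle p (pair (e + 2) (pair m (digit m z))) \<noteq> None}"
  assumes sets: "W \<in> sets lam" and le: "measure lam W \<le> (1 / 2) ^ (e + 2)"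
  shows "run empty_oracle p (pair (e + 2) (pair L (omega L))) = None"
proof (rule ccontr)
  assume "run empty_oracle p (pair (e + 2) (pair L (omega L))) \<noteq> None"
  then obtain c where c: "halts_by e (pair (e + 2) (pair L (omega L))) c"
    using halts_by_iff e_def by blast
  have "{z. covered e t (digit t z)} \<subseteq> W" for t
    unfolding W_def covered_digit enum_def e_def using halts_by_iff by blast
  then have adm: "admissible e t" for t
    unfolding admissible_iff using lam.finite_measure_mono[OF _ sets] le by (meson order_trans)
  obtain t0 where t0: "\<And>s. t0 \<le> s \<Longrightarrow> approx L s = omega L" using approx_eq_omega by blast
  \<comment> \<open>At this stage digit \<open>L\<close> of the approximation is final, the
    certificate \<open>c\<close> has been seen, and test \<open>e\<close> is active.\<close>
  define t where "t = Suc (t0 + L + c + e)"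
  have t: "t0 \<le> t" "L \<le> t" "c < t" "e < t" by (auto simp: t_def)
  have "omega L = leftmost t div 2 ^ (t - L)"
    using t0[OF t(1)] approx_div[OF t(2), of t] by (simp add: approx_def)
  then have "covered e t (leftmost t)"
    unfolding covered_def enum_def using c t by (intro exI[of _ L]) auto
  then have "bad t (leftmost t)"
    unfolding bad_def using t adm by (intro exI[of _ e] exI[of _ t]) auto
  then show False using leftmost_not_bad by blast
qed

lemma decidable_covered:
  assumes "computable_in A f" "computable_in A g" "computable_in A h"
  shows "decidable_in A (\<lambda>x. covered (f x) (g x) (h x))"
proof -
  have "decidable_in A (\<lambda>z. covered (p1 (p1 z)) (p2 (p1 z)) (p2 z))"
    unfolding covered_def enum_def by (intro comp_intros)
  from decidable_comp[OF this, of "\<lambda>x. pair (pair (f x) (g x)) (h x)"]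
  show ?thesis by (simp add: comp_intros assms)
qed

lemma decidable_admissible:
  assumes "computable_in A f" "computable_in A g"
  shows "decidable_in A (\<lambda>x. admissible (f x) (g x))"
proof -
  have "decidable_in A (\<lambda>z. admissible (p1 z) (p2 z))"
    unfolding admissible_def by (intro comp_intros decidable_covered)
  from decidable_comp[OF this, of "\<lambda>x. pair (f x) (g x)"]
  show ?thesis by (simp add: comp_intros assms)
qed

lemma computable_approx [comp_intros]:
  assumes "computable_in A f" "computable_in A g"
  shows "computable_in A (\<lambda>x. approx (f x) (g x))"
proof -
  have left: "computable_in A leftmost"
    unfolding leftmost_def[abs_def] bad_def
    by (intro comp_intros decidable_covered decidable_admissible)
      (use ex_not_bad[unfolded bad_def] in blast)
  show ?thesis
    unfolding approx_def by (intro comp_intros computable_comp[OF left] assms)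
qed

text \<open>Otherwise \<Omega> would be the dyadic rational of stage \<open>t\<close>, and the
  dyadic intervals containing it would form a test that captures it.\<close>

lemma omega_not_attained: "\<exists>m. omega m \<noteq> approx m t"
proof (rule ccontr)
  assume "\<not> (\<exists>m. omega m \<noteq> approx m t)"
  then have eq: "omega m = approx m t" for m by simp
  \<comment> \<open>At level \<open>i\<close> the test lists the intervals around that rational of
    resolution \<open>m \<ge> i\<close>; they are nested, so their union is the one of length
    \<open>1 / 2 ^ i\<close>.\<close>
  have "decidable_in empty_oracle (\<lambda>x. p1 x \<le> p1 (p2 x) \<and> p2 (p2 x) = approx (p1 (p2 x)) t)"
    by (intro comp_intros)
  then obtain p where p: "\<And>x. run empty_oracle p x \<noteq> None \<longleftrightarrow>
      p1 x \<le> p1 (p2 x) \<and> p2 (p2 x) = approx (p1 (p2 x)) t"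
    using semidecidable by blast
  define i where "i = prog_num p + 2"
  define W where "W = {z. \<exists>m. run empty_oracle p (pair i (pair m (digit m z))) \<noteq> None}"
  have W: "W = {z. \<exists>m\<ge>i. digit m z = approx m t}" unfolding W_def p by simp
  have "W = {z. digit i z \<in> {approx i t}}"
    unfolding W using digit_div approx_div by auto (metis+)
  then have "measure lam W \<le> (1 / 2) ^ i"
    by (simp only: measure_digit) (auto simp: field_simps card_le_Suc0_iff_eq)
  moreover have "W \<in> sets lam" unfolding W by measurable
  ultimately have "run empty_oracle p (pair i (pair i (omega i))) = None"
    using omega_random[of p i] unfolding i_def W_def by blast
  then show False using p[of "pair i (pair i (omega i))"] eq by simp
qed

section \<open>The trivial measure\<close>

definition path :: "real \<Rightarrow> cantor" where
  "path z i \<longleftrightarrow> digit (p1 i) z \<le> approx (p1 i) (p2 i)"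

text \<open>The image of \<Omega>, with \<open>omega\<close> in place of digits, since \<Omega> is
  never formed as a real number.\<close>

definition limit_path :: cantor where
  "limit_path i \<longleftrightarrow> omega (p1 i) \<le> approx (p1 i) (p2 i)"

text \<open>Bit \<open>i\<close> of a path only depends on digit number \<open>p1 i \<le> i\<close>, so \<open>prefix L k\<close> is the common
  initial segment of length \<open>L\<close> of all paths of reals \<open>z\<close> with \<open>digit L z = k\<close>.\<close>

definition prefix :: "nat \<Rightarrow> nat \<Rightarrow> bool list" where
  "prefix L k = map (\<lambda>i. k div 2 ^ (L - p1 i) \<le> approx (p1 i) (p2 i)) [0..<L]"

definition mu :: "cantor measure" where
  "mu = distr lam borel path"

lemma p1_le: "i < L \<Longrightarrow> p1 i \<le> L"
  using le_prod_encode_1[of "p1 i" "p2 i"] by simp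

lemma prefix_digit: "prefix L (digit L z) = map (path z) [0..<L]"
  unfolding prefix_def path_def by (intro map_cong) (simp_all add: digit_div p1_le)

lemma prefix_omega: "prefix L (omega L) = map limit_path [0..<L]"
  unfolding prefix_def limit_path_def by (intro map_cong) (simp_all add: omega_div p1_le)

section \<open>Cylinders and measurability\<close>

lemma cyl_iff: "Y \<in> cyl \<sigma> \<longleftrightarrow> map Y [0..<length \<sigma>] = \<sigma>"
proof -
  have "map Y [0..<length \<sigma>] = \<sigma> \<longleftrightarrow> (\<forall>i<length \<sigma>. map Y [0..<length \<sigma>] ! i = \<sigma> ! i)"
    unfolding list_eq_iff_nth_eq by simp
  then show ?thesis by (simp add: cyl_def)
qed

lemma path_in_cyl: "path z \<in> cyl \<sigma> \<longleftrightarrow> prefix (length \<sigma>) (digit (length \<sigma>) z) = \<sigma>"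
  by (simp only: cyl_iff prefix_digit)

lemma open_cyl: "open (cyl \<sigma>)"
proof -
  have "cyl \<sigma> = (\<Inter>i<length \<sigma>. (\<lambda>X. X i) -` {\<sigma> ! i})" by (auto simp: cyl_def)
  also have "open \<dots>"
    by (intro open_INT finite_lessThan ballI open_vimage continuous_on_product_coordinates
        discrete_topology_class.open_discrete)
  finally show ?thesis .
qed

lemma cyl_borel [measurable]: "cyl \<sigma> \<in> sets borel"
  by (rule borel_open[OF open_cyl])

lemma Inter_cyl: "(\<Inter>L. cyl (map Y [0..<L])) = {Y}"
proof -
  have "Z = Y" if "Z \<in> (\<Inter>L. cyl (map Y [0..<L]))" for Z
  proof
    fix i
    have "Z \<in> cyl (map Y [0..<Suc i])" using that by blast
    then show "Z i = Y i" by (simp add: cyl_def del: upt_Suc)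
  qed
  then show ?thesis by (auto simp: cyl_def)
qed

lemma singleton_borel: "{Y :: cantor} \<in> sets borel"
  unfolding Inter_cyl[symmetric] by measurable

text \<open>Needed for coordinatewise measurability of \<open>path\<close> to imply Borel
  measurability.\<close>

instance bool :: second_countable_topology
proof
  have "open = generate_topology (UNIV :: bool set set)"
    by (auto simp: fun_eq_iff discrete_topology_class.open_discrete intro: generate_topology.Basis)
  then show "\<exists>B :: bool set set. countable B \<and> open = generate_topology B"
    by (intro exI[of _ UNIV]) (simp add: countable_finite)
qed

lemma measurable_path [measurable]: "path \<in> lam \<rightarrow>\<^sub>M borel"
proof (rule measurable_coordinatewise_then_product)
  fix i
  have "(\<lambda>z. digit (p1 i) z \<le> approx (p1 i) (p2 i)) \<in> lam \<rightarrow>\<^sub>M count_space UNIV" by measurable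
  then show "(\<lambda>z. path z i) \<in> borel_measurable lam"
    unfolding path_def by (subst measurable_cong_sets[OF refl sets_borel_eq_count_space]) simp
qed

lemma sets_mu [simp, measurable_cong]: "sets mu = sets borel"
  by (simp add: mu_def)

lemma space_mu [simp]: "space mu = UNIV"
  by (simp add: mu_def)

lemma prob_space_mu: "prob_space mu"
  unfolding mu_def by (rule lam.prob_space_distr) measurable

interpretation mu: prob_space mu
  by (rule prob_space_mu)

lemma measure_mu: "S \<in> sets borel \<Longrightarrow> measure mu S = measure lam {z. path z \<in> S}"
  unfolding mu_def by (subst measure_distr) (auto simp: vimage_def)

section \<open>Computability of the measure\<close>

lemma string_num_inject: "string_num \<sigma> = string_num \<tau> \<longleftrightarrow> \<sigma> = \<tau>"
proof -
  have "inj (of_bool :: bool \<Rightarrow> nat)" by (auto simp: inj_def)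
  then have "map of_bool \<sigma> = (map of_bool \<tau> :: nat list) \<longleftrightarrow> \<sigma> = \<tau>" by (rule inj_map_eq_map)
  then show ?thesis unfolding string_num_def by (simp only: list_encode_eq)
qed

lemma length_le_string_num: "length \<sigma> \<le> string_num \<sigma>"
  unfolding string_num_def
proof (induction \<sigma>)
  case (Cons b \<sigma>)
  then show ?case using le_prod_encode_2[of "list_encode (map of_bool \<sigma>)" "of_bool b"]
    by simp
qed simp

text \<open>Strings of length at most \<open>N\<close> are compared at resolution \<open>2\<^sup>-\<^sup>N\<close>, which avoids decoding
  the length of the string with number \<open>N\<close>.\<close>

definition cyl_count :: "nat \<Rightarrow> nat" where
  "cyl_count N = card {k. k < 2 ^ N \<and> (\<exists>L<Suc N. string_num (prefix L (k div 2 ^ (N - L))) = N)}"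

lemma length_prefix [simp]: "length (prefix L k) = L"
  by (simp add: prefix_def)

text \<open>A string is no longer than its number \<open>N\<close>, so digit \<open>N\<close> of a
  real determines whether its path lies in the cylinder. Cylinder measures are thus exact dyadic
  rationals.\<close>

lemma measure_cyl: "measure mu (cyl \<sigma>) = cyl_count (string_num \<sigma>) / 2 ^ string_num \<sigma>"
proof -
  define N where "N = string_num \<sigma>"
  define S where "S = {k. \<exists>L<Suc N. string_num (prefix L (k div 2 ^ (N - L))) = N}"
  have "path z \<in> cyl \<sigma> \<longleftrightarrow> digit N z \<in> S" for z
  proof -
    have "digit N z \<in> S \<longleftrightarrow> (\<exists>L\<le>N. prefix L (digit L z) = \<sigma>)"
      unfolding S_def by (auto simp: less_Suc_eq_le digit_div N_def string_num_inject)
    also have "\<dots> \<longleftrightarrow> prefix (length \<sigma>) (digit (length \<sigma>) z) = \<sigma>"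
      using length_le_string_num[of \<sigma>] length_prefix unfolding N_def by metis
    finally show ?thesis unfolding path_in_cyl by simp
  qed
  then have "measure mu (cyl \<sigma>) = measure lam {z. digit N z \<in> S}"
    by (simp add: measure_mu)
  also have "\<dots> = cyl_count N / 2 ^ N"
    unfolding measure_digit cyl_count_def S_def by simp
  finally show ?thesis unfolding N_def .
qed

lemma computable_prefix [comp_intros]:
  assumes "computable_in A f" "computable_in A g"
  shows "computable_in A (\<lambda>x. string_num (prefix (f x) (g x)))"
proof -
  have "computable_in A (\<lambda>x. list_encode (map ((\<lambda>x i. of_bool
      (p2 x div 2 ^ (p1 x - p1 i) \<le> approx (p1 i) (p2 i))) x) [0..<p1 x]))"
    by (rule computable_list_encode) (intro comp_intros)+
  then have "computable_in A (\<lambda>x. string_num (prefix (p1 x) (p2 x)))"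
    by (simp add: string_num_def prefix_def comp_def)
  from computable_comp[OF this computable_pair[OF assms]] show ?thesis by simp
qed

lemma computable_cyl_count [comp_intros]:
  assumes "computable_in A f" shows "computable_in A (\<lambda>x. cyl_count (f x))"
proof -
  have "computable_in A cyl_count"
    unfolding cyl_count_def[abs_def] by (intro comp_intros)
  from computable_comp[OF this assms] show ?thesis .
qed

lemma computable_measure_mu: "computable_measure mu"
  unfolding computable_measure_def
proof (intro exI conjI allI)
  \<comment> \<open>The factor 2 is the integer coding: \<open>int_decode\<close> sends
    \<open>2 * n\<close> to \<open>n\<close>. The value is exact for every precision.\<close>
  let ?f = "\<lambda>x. pair (2 * cyl_count (p1 x)) (p1 x)"
  show "computable_in empty_oracle ?f" by (intro comp_intros)
  have "int_encode (int n) = 2 * n" for n by (simp add: int_encode_def sum_encode_def)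
  then have "int_decode (2 * n) = int n" for n by (metis int_encode_inverse)
  then show "\<bar>measure mu (cyl \<sigma>) - dyadic (?f (pair (string_num \<sigma>) i))\<bar> \<le> (1 / 2) ^ i" for \<sigma> i
    by (simp add: dyadic_def measure_cyl)
qed

section \<open>Randomness of the atoms and of the limit path\<close>

lemma effectively_open_borel:
  assumes "uniformly_effectively_open A U" shows "U i \<in> sets borel"
proof -
  obtain p where "\<And>i. U i = (\<Union>\<sigma>\<in>{\<sigma>. run A p (pair i (string_num \<sigma>)) \<noteq> None}. cyl \<sigma>)"
    using assms unfolding uniformly_effectively_open_def by blast
  then show ?thesis using open_cyl by (intro borel_open) auto
qed

text \<open>A level whose bound is below the mass of the atom cannot contain it, whatever the
  oracle.\<close>

lemma Atoms_subset_MLR_rel: "Atoms mu \<subseteq> MLR_rel A mu"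
proof
  fix Y assume Y: "Y \<in> Atoms mu"
  show "Y \<in> MLR_rel A mu"
    unfolding MLR_rel_def
  proof (intro CollectI allI impI notI)
    fix U assume U: "martin_loef_test A mu U" "Y \<in> (\<Inter>i. U i)"
    obtain i where i: "(1 / 2) ^ i < measure mu {Y}"
      using Y real_arch_pow_inv[of "measure mu {Y}" "1 / 2"] by (auto simp: Atoms_def)
    have "U i \<in> sets mu"
      using U effectively_open_borel[of A U i] by (simp add: martin_loef_test_def)
    then have "measure mu {Y} \<le> measure mu (U i)"
      using U by (intro mu.finite_measure_mono) auto
    also have "\<dots> \<le> (1 / 2) ^ i" using U by (simp add: martin_loef_test_def)
    finally show False using i by simp
  qed
qed

text \<open>Running the test on \<open>prefix L k\<close> pulls it back to dyadic intervals with the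
  same measures. As \<open>prefix L (omega L)\<close> is an initial segment of
  \<open>limit_path\<close>, capturing the path would contradict
  \<open>omega_random\<close>.\<close>

lemma limit_path_MLR: "limit_path \<in> MLR mu"
  unfolding MLR_def MLR_rel_def
proof (intro CollectI allI impI notI)
  fix U assume U: "martin_loef_test empty_oracle mu U" and X: "limit_path \<in> (\<Inter>i. U i)"
  then obtain p where p: "\<And>i. U i = (\<Union>\<sigma>\<in>{\<sigma>. run empty_oracle p (pair i (string_num \<sigma>)) \<noteq> None}. cyl \<sigma>)"
    unfolding martin_loef_test_def uniformly_effectively_open_def by blast
  have "computable_in empty_oracle (\<lambda>x. pair (p1 x) (string_num (prefix (p1 (p2 x)) (p2 (p2 x)))))"
    by (intro comp_intros)
  then obtain q where "\<And>x. run empty_oracle q x =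
      Some (pair (p1 x) (string_num (prefix (p1 (p2 x)) (p2 (p2 x)))))"
    unfolding computable_in_def by blast
  then have q: "run empty_oracle (Comp p q) (pair i (pair L k)) =
      run empty_oracle p (pair i (string_num (prefix L k)))" for i L k
    by simp
  define i where "i = prog_num (Comp p q) + 2"
  define W where "W = {z. \<exists>m. run empty_oracle (Comp p q) (pair i (pair m (digit m z))) \<noteq> None}"
  have W: "W = {z. path z \<in> U i}"
  proof -
    have "(\<exists>m. run empty_oracle (Comp p q) (pair i (pair m (digit m z))) \<noteq> None) \<longleftrightarrow> path z \<in> U i"
      for z
    proof -
      have "(\<exists>m. run empty_oracle (Comp p q) (pair i (pair m (digit m z))) \<noteq> None) \<longleftrightarrow>
          (\<exists>\<sigma>. prefix (length \<sigma>) (digit (length \<sigma>) z) = \<sigma> \<and>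
            run empty_oracle p (pair i (string_num \<sigma>)) \<noteq> None)"
        unfolding q by (metis length_prefix)
      then show ?thesis unfolding p using path_in_cyl by blast
    qed
    then show ?thesis unfolding W_def by presburger
  qed
  have "U i \<in> sets borel"
    using U effectively_open_borel[of empty_oracle U i] by (simp add: martin_loef_test_def)
  then have "W \<in> sets lam" "measure lam W = measure mu (U i)"
    unfolding W using measurable_sets[OF measurable_path] by (auto simp: measure_mu vimage_def)
  moreover have "measure mu (U i) \<le> (1 / 2) ^ i" using U by (simp add: martin_loef_test_def)
  ultimately have none: "run empty_oracle (Comp p q) (pair i (pair L (omega L))) = None" for L
    using omega_random[of "Comp p q" L] unfolding i_def W_def by simp
  have "limit_path \<in> U i" using X by blast
  then obtain \<sigma> where "run empty_oracle p (pair i (string_num \<sigma>)) \<noteq> None" "limit_path \<in> cyl \<sigma>"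
    unfolding p by blast
  moreover from this have "prefix (length \<sigma>) (omega (length \<sigma>)) = \<sigma>"
    by (simp add: prefix_omega cyl_iff)
  ultimately show False using none[of "length \<sigma>"] q by metis
qed

text \<open>At a stage \<open>t\<close> with \<open>approx n t = omega n\<close>, equal bits rule
  out a larger digit. A smaller digit stays below \<open>approx m t\<close> for all
  \<open>m \<ge> n\<close>; equal bits then force \<open>omega m = approx m t\<close>, so stage
  \<open>t\<close> would attain \<Omega>.\<close>

lemma path_eq_limit_path:
  assumes "path z = limit_path" shows "digit n z = omega n"
proof (rule ccontr)
  obtain t where t: "approx n t = omega n" using approx_eq_omega by blast
  have iff: "digit m z \<le> approx m t \<longleftrightarrow> omega m \<le> approx m t" for m
    using fun_cong[OF assms, of "pair m t"] by (simp add: path_def limit_path_def)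
  assume "digit n z \<noteq> omega n"
  then have less: "digit n z < omega n" using iff[of n] t by simp
  have "omega m = approx m t" for m
  proof (cases "n \<le> m")
    case True
    have "digit m z < approx m t"
      using less t True by (metis approx_div digit_div div_le_mono not_le)
    then show ?thesis using iff[of m] approx_le_omega[of m t] by simp
  next
    case False
    then show ?thesis using t approx_div[of m n t] omega_div[of m n] by simp
  qed
  then show False using omega_not_attained by blast
qed

lemma limit_path_not_atom: "measure mu {limit_path} = 0"
proof -
  have "measure mu {limit_path} \<le> (1 / 2) ^ n" for n
  proof -
    have "measure mu {limit_path} = measure lam {z. path z \<in> {limit_path}}"
      by (rule measure_mu[OF singleton_borel])
    also have "\<dots> \<le> measure lam {z. digit n z \<in> {omega n}}"
    proof (rule lam.finite_measure_mono)
      show "{z. digit n z \<in> {omega n}} \<in> sets lam"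
        using measurable_sets[OF measurable_digit, of "{omega n}" n] by (simp add: vimage_def)
    qed (use path_eq_limit_path in auto)
    also have "\<dots> \<le> (1 / 2) ^ n"
    proof -
      have "card {k. k < 2 ^ n \<and> k \<in> {omega n}} \<le> card {omega n}" by (rule card_mono) auto
      then show ?thesis unfolding measure_digit by (simp add: power_one_over divide_right_mono field_simps)
    qed
    finally show ?thesis .
  qed
  then have "measure mu {limit_path} \<le> 0"
    by (intro LIMSEQ_le_const[OF LIMSEQ_power_zero[of "1 / 2 :: real"]]) auto
  then show ?thesis by (simp add: measure_le_0_iff)
qed

text \<open>As \<open>omega n\<close> is the maximum of \<open>approx n\<close>, a bit is false
  exactly when some stage exceeds the given one, a question that the halting set answers.\<close>

lemma limit_path_computable: "decidable_in halting_set limit_path"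
proof -
  have "decidable_in empty_oracle (\<lambda>z. approx (p1 (p1 z)) (p2 (p1 z)) < approx (p1 (p1 z)) (p2 z))"
    by (intro comp_intros)
  from decidable_not[OF halting_set_decides[OF this[folded prod_encode_inverse]]]
  have "decidable_in halting_set (\<lambda>x. \<not> (\<exists>t. approx (p1 x) (p2 x) < approx (p1 x) t))"
    by simp
  moreover have "limit_path x \<longleftrightarrow> \<not> (\<exists>t. approx (p1 x) (p2 x) < approx (p1 x) t)" for x
    unfolding limit_path_def using approx_le_omega approx_eq_omega[of "p1 x"] by (metis le_trans not_le order_refl)
  ultimately show ?thesis by presburger
qed

text \<open>Level \<open>i\<close> collects the cylinders of those initial segments of
  \<open>Y\<close> with measure at most \<open>(1 / 2) ^ i\<close>. They are nested, so the largest
  bounds the union; they exist because the measures tend to that of \<open>{Y}\<close>.\<close>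

lemma computable_nonatom_not_MLR_rel:
  assumes "measure mu {Y} = 0" "decidable_in A Y"
  shows "Y \<notin> MLR_rel A mu"
proof -
  have code: "string_num (map Y [0..<L]) = list_encode (map ((\<lambda>x i. of_bool (Y i)) x) [0..<L])" for L x
    by (simp add: string_num_def comp_def)
  have "computable_in A (\<lambda>L. list_encode (map ((\<lambda>x i. of_bool (Y i)) L) [0..<L]))"
    by (rule computable_list_encode) (intro comp_intros decidable_comp[OF assms(2)])+
  then have "computable_in A (\<lambda>L. string_num (map Y [0..<L]))" unfolding code .
  note c = computable_comp[OF this]
  have "decidable_in A (\<lambda>x. (\<exists>L<Suc (p2 x). string_num (map Y [0..<L]) = p2 x) \<and>
      cyl_count (p2 x) * 2 ^ p1 x \<le> 2 ^ p2 x)"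
    by (intro comp_intros c)
  then obtain p where p: "\<And>x. run A p x \<noteq> None \<longleftrightarrow>
      (\<exists>L<Suc (p2 x). string_num (map Y [0..<L]) = p2 x) \<and> cyl_count (p2 x) * 2 ^ p1 x \<le> 2 ^ p2 x"
    using semidecidable by blast
  define U where "U i = (\<Union>\<sigma>\<in>{\<sigma>. run A p (pair i (string_num \<sigma>)) \<noteq> None}. cyl \<sigma>)" for i
  have small: "cyl_count N * 2 ^ i \<le> 2 ^ N \<longleftrightarrow> cyl_count N / 2 ^ N \<le> (1 / 2) ^ i" for N i
  proof -
    have "cyl_count N * 2 ^ i \<le> 2 ^ N \<longleftrightarrow> real (cyl_count N * 2 ^ i) \<le> real (2 ^ N)"
      unfolding of_nat_le_iff ..
    then show ?thesis by (simp add: field_simps)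
  qed
  have len: "(\<exists>L<Suc (string_num \<sigma>). string_num (map Y [0..<L]) = string_num \<sigma>) \<longleftrightarrow>
      (\<exists>L. \<sigma> = map Y [0..<L])" for \<sigma>
    unfolding string_num_inject using length_le_string_num[of \<sigma>]
    by (metis less_Suc_eq_le length_map length_upt diff_zero)
  have U: "U i = (\<Union>L\<in>{L. measure mu (cyl (map Y [0..<L])) \<le> (1 / 2) ^ i}. cyl (map Y [0..<L]))" for i
    unfolding U_def p by (auto simp: len small measure_cyl)
  have mono: "cyl (map Y [0..<M]) \<subseteq> cyl (map Y [0..<L])" if "L \<le> M" for L M
    using that by (auto simp: cyl_def)
  have "measure mu (U i) \<le> (1 / 2) ^ i" for i
  proof (cases "\<exists>L. measure mu (cyl (map Y [0..<L])) \<le> (1 / 2) ^ i")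
    case True
    define L where "L = (LEAST L. measure mu (cyl (map Y [0..<L])) \<le> (1 / 2) ^ i)"
    have L: "measure mu (cyl (map Y [0..<L])) \<le> (1 / 2) ^ i"
      unfolding L_def using True by (rule LeastI_ex)
    have "U i \<subseteq> cyl (map Y [0..<L])"
      unfolding U
    proof (intro UN_least)
      fix M assume "M \<in> {L. measure mu (cyl (map Y [0..<L])) \<le> (1 / 2) ^ i}"
      then have "L \<le> M" unfolding L_def by (intro Least_le) simp
      then show "cyl (map Y [0..<M]) \<subseteq> cyl (map Y [0..<L])" by (rule mono)
    qed
    then have "measure mu (U i) \<le> measure mu (cyl (map Y [0..<L]))"
      by (intro mu.finite_measure_mono) auto
    then show ?thesis using L by simp
  next
    case False
    then have "U i = {}" unfolding U by auto
    then show ?thesis by simp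
  qed
  then have "martin_loef_test A mu U"
    unfolding martin_loef_test_def uniformly_effectively_open_def U_def by blast
  moreover have "Y \<in> U i" for i
  proof -
    have "(\<lambda>L. measure mu (cyl (map Y [0..<L]))) \<longlonglongrightarrow> measure mu (\<Inter>L. cyl (map Y [0..<L]))"
      by (rule mu.finite_Lim_measure_decseq) (use mono in \<open>auto simp: decseq_def\<close>)
    then have "(\<lambda>L. measure mu (cyl (map Y [0..<L]))) \<longlonglongrightarrow> 0"
      using assms(1) by (simp add: Inter_cyl)
    then have "\<forall>\<^sub>F L in sequentially. measure mu (cyl (map Y [0..<L])) < (1 / 2) ^ i"
      by (rule order_tendstoD) simp
    then obtain L where "measure mu (cyl (map Y [0..<L])) < (1 / 2) ^ i"
      by (auto simp: eventually_sequentially)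
    then show ?thesis unfolding U by (intro UN_I[of L]) (auto simp: cyl_def)
  qed
  ultimately show ?thesis unfolding MLR_rel_def by blast
qed

lemma null_cyl_not_MLR_rel:
  assumes "Y \<in> cyl \<sigma>" "measure mu (cyl \<sigma>) = 0"
  shows "Y \<notin> MLR_rel A mu"
proof -
  have "decidable_in A (\<lambda>x. p2 x = string_num \<sigma>)" by (intro comp_intros)
  then obtain p where p: "\<And>x. run A p x \<noteq> None \<longleftrightarrow> p2 x = string_num \<sigma>"
    using semidecidable by blast
  have "cyl \<sigma> = (\<Union>\<tau>\<in>{\<tau>. run A p (pair i (string_num \<tau>)) \<noteq> None}. cyl \<tau>)" for i
    unfolding p by (simp add: string_num_inject)
  then have "martin_loef_test A mu (\<lambda>_. cyl \<sigma>)"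
    unfolding martin_loef_test_def uniformly_effectively_open_def using assms(2) by auto
  then show ?thesis unfolding MLR_rel_def using assms(1) by blast
qed

section \<open>The support of the measure\<close>

lemma computable_table [comp_intros]:
  assumes "computable_in A g" "computable_in A h"
  shows "computable_in A (\<lambda>x. if g x < n then f (g x) else h x)"
proof (induction n)
  case (Suc n)
  have "computable_in A (\<lambda>x. if g x = n then f n else if g x < n then f (g x) else h x)"
    by (intro computable_if comp_intros assms Suc)
  moreover have "(if g x = n then f n else if g x < n then f (g x) else h x) =
      (if g x < Suc n then f (g x) else h x)" for x by auto
  ultimately show ?case by simp
qed (simp add: assms)

text \<open>Row \<open>m\<close> of a limit of paths is \<open>False\<close> up to some threshold \<open>f m\<close> and \<open>True\<close> from there on.
  If all thresholds are finite and unbounded, then the reals behind the paths converge to \<open>\<Omega>\<close>;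
  otherwise only finitely many thresholds carry information.\<close>

lemma support_cases:
  assumes "\<And>L. \<exists>z. map Y [0..<L] = map (path z) [0..<L]"
  shows "Y = limit_path \<or> (\<forall>A. decidable_in A Y)"
proof -
  have ex: "\<exists>z. \<forall>i\<in>I. Y i \<longleftrightarrow> path z i" if "finite I" for I
  proof -
    obtain z where "map Y [0..<Suc (Max I)] = map (path z) [0..<Suc (Max I)]" using assms by blast
    then have "Y i \<longleftrightarrow> path z i" if "i \<le> Max I" for i using that by (simp del: upt_Suc)
    then show ?thesis using Max_ge[OF that] by blast
  qed
  define row where "row m t \<longleftrightarrow> Y (pair m t)" for m t
  have Y_row: "Y i \<longleftrightarrow> row (p1 i) (p2 i)" for i by (simp add: row_def)
  have exrow: "\<exists>z. \<forall>(m, t)\<in>I. row m t \<longleftrightarrow> digit m z \<le> approx m t" if "finite I" for I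
    using ex[of "prod_encode ` I"] that by (auto simp: row_def path_def split_beta)
  have row_mono: "row m t'" if "row m t" "t \<le> t'" for m t t'
    using exrow[of "{(m, t), (m, t')}"] that approx_mono[of t t' m] by auto
  define f where "f m = (LEAST t. row m t)" for m
  have row_f: "row m t \<longleftrightarrow> f m \<le> t" if "\<exists>t. row m t" for m t
    unfolding f_def using that row_mono by (metis LeastI_ex Least_le)
  show ?thesis
  proof (cases "\<exists>n. \<forall>t. \<not> row n t")
    case True
    define n where "n = (LEAST n. \<forall>t. \<not> row n t)"
    have n: "\<not> row n t" for t using LeastI_ex[OF True] by (simp add: n_def)
    have below: "\<exists>t. row m t" if "m < n" for m using not_less_Least[of m] that by (auto simp: n_def)
    \<comment> \<open>A true bit in row \<open>m\<close> yields a real \<open>z\<close> with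
      \<open>digit n z \<le> omega n\<close>, while the false bit chosen in row \<open>n\<close>
      says the opposite.\<close>
    have above: "\<not> row m t" if "n \<le> m" for m t
    proof
      assume "row m t"
      obtain t' where t': "approx n t' = omega n" using approx_eq_omega by blast
      obtain z where "digit m z \<le> approx m t" "\<not> digit n z \<le> omega n"
        using exrow[of "{(m, t), (n, t')}"] \<open>row m t\<close> n[of t'] t' by auto
      then have "digit m z \<le> omega m" using approx_le_omega le_trans by blast
      then have "digit n z \<le> omega n" using that by (metis digit_div omega_div div_le_mono)
      then show False using \<open>\<not> digit n z \<le> omega n\<close> by blast
    qed
    \<comment> \<open>The thresholds below \<open>n\<close> form a finite table; the default
      \<open>Suc (p2 i)\<close> exceeds \<open>p2 i\<close> and so encodes the rows that are
      constantly false.\<close>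
    have "Y i \<longleftrightarrow> (if p1 i < n then f (p1 i) else Suc (p2 i)) \<le> p2 i" for i
      using above row_f[OF below] by (auto simp: Y_row not_less)
    moreover have "decidable_in A (\<lambda>i. (if p1 i < n then f (p1 i) else Suc (p2 i)) \<le> p2 i)" for A
      by (intro decidable_le computable_table comp_intros)
    ultimately show ?thesis by presburger
  next
    case False
    then have row_iff: "row m t \<longleftrightarrow> f m \<le> t" for m t using row_f by blast
    have "f m \<le> f n" if "m \<le> n" for m n
    proof -
      obtain z where "row n (f n) \<longleftrightarrow> digit n z \<le> approx n (f n)"
          "row m (f n) \<longleftrightarrow> digit m z \<le> approx m (f n)"
        using exrow[of "{(n, f n), (m, f n)}"] by auto
      then show ?thesis using that by (metis row_iff order_refl digit_div approx_div div_le_mono)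
    qed
    note f_mono = this
    show ?thesis
    proof (cases "\<exists>b. \<forall>m. f m \<le> b")
      case True
      then obtain b where "range f \<subseteq> {..b}" by blast
      then have fin: "finite (range f)" by (rule finite_subset) simp
      then have "Max (range f) \<in> range f" by (rule Max_in) simp
      then obtain n where n: "f n = Max (range f)" by (metis imageE)
      \<comment> \<open>Bounded nondecreasing thresholds are eventually constant, so a finite table
        again suffices.\<close>
      have "f m = f n" if "n \<le> m" for m
      proof (rule le_antisym)
        show "f m \<le> f n" unfolding n using fin by (rule Max_ge) simp
      qed (rule f_mono[OF that])
      then have "(if p1 i < n then f (p1 i) else f n) = f (p1 i)" for i by (metis not_less)
      then have "Y i \<longleftrightarrow> (if p1 i < n then f (p1 i) else f n) \<le> p2 i" for i
        by (simp only: Y_row row_iff)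
      moreover have "decidable_in A (\<lambda>i. (if p1 i < n then f (p1 i) else f n) \<le> p2 i)" for A
        by (intro decidable_le computable_table comp_intros)
      ultimately show ?thesis by presburger
    next
      case False
      \<comment> \<open>A finer row \<open>n\<close> is still false at a stage \<open>t'\<close>
        where digit \<open>m\<close> is final, which forces \<open>omega m \<le> digit m z\<close>;
        the true bit at \<open>f m\<close> gives the converse.\<close>
      have "row m t \<longleftrightarrow> omega m \<le> approx m t" for m t
      proof -
        obtain t' where t': "approx m t' = omega m" using approx_eq_omega by blast
        obtain l where "t' < f l" using False by (meson not_le)
        define n where "n = max l m"
        have n: "m \<le> n" "t' < f n" using f_mono[of l n] \<open>t' < f l\<close> by (auto simp: n_def)
        obtain z where z: "row m t \<longleftrightarrow> digit m z \<le> approx m t"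
            "digit m z \<le> approx m (f m)" "\<not> digit n z \<le> approx n t'"
          using exrow[of "{(m, t), (m, f m), (n, t')}"] n(2) row_iff by auto
        have "omega m \<le> digit m z"
          using z(3) n(1) t' by (metis approx_div digit_div div_le_mono nle_le)
        then have "digit m z = omega m"
          using z(2) approx_le_omega[of m "f m"] by simp
        then show ?thesis using z(1) by simp
      qed
      then have "Y = limit_path" by (auto simp: Y_row limit_path_def)
      then show ?thesis ..
    qed
  qed
qed

text \<open>A non-atom either has an initial segment that no path shares, and lies in a null
  cylinder, or is computable from the halting set by \<open>support_cases\<close>. A test captures
  it in both cases.\<close>

lemma two_MLR_subset_Atoms: "two_MLR mu \<subseteq> Atoms mu"
proof
  fix Y assume Y: "Y \<in> two_MLR mu"
  show "Y \<in> Atoms mu"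
  proof (rule ccontr)
    assume "Y \<notin> Atoms mu"
    then have null: "measure mu {Y} = 0" by (simp add: Atoms_def zero_less_measure_iff)
    show False
    proof (cases "\<forall>L. \<exists>z. map Y [0..<L] = map (path z) [0..<L]")
      case True
      then have "decidable_in halting_set Y" using support_cases limit_path_computable by blast
      then show False using computable_nonatom_not_MLR_rel[OF null] Y unfolding two_MLR_def by blast
    next
      case False
      then obtain L where L: "\<And>z. map Y [0..<L] \<noteq> map (path z) [0..<L]" by blast
      then have "path z \<notin> cyl (map Y [0..<L])" for z unfolding cyl_iff by (metis length_map length_upt diff_zero)
      then have "measure mu (cyl (map Y [0..<L])) = 0" by (simp add: measure_mu)
      then show False
        using null_cyl_not_MLR_rel[of Y "map Y [0..<L]"] Y unfolding two_MLR_def by (auto simp: cyl_def)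
    qed
  qed
qed

lemma countable_decidable: "countable {Y. decidable_in A Y}"
proof -
  have "inj prog_num" by (auto simp: inj_def prog_num_inject)
  then have "countable (UNIV :: prog set)" by (rule countableI')
  moreover have "{Y. decidable_in A Y} \<subseteq> range (\<lambda>p x. run A p x = Some 1)"
  proof
    fix Y assume "Y \<in> {Y. decidable_in A Y}"
    then obtain p where "\<And>x. run A p x = Some (of_bool (Y x))"
      unfolding decidable_in_def computable_in_def by blast
    then have "Y = (\<lambda>x. run A p x = Some 1)" by auto
    then show "Y \<in> range (\<lambda>p x. run A p x = Some 1)" by blast
  qed
  ultimately show ?thesis by (meson countable_image countable_subset)
qed

text \<open>By \<open>support_cases\<close> every path is computable or equals
  \<open>limit_path\<close>, so \<open>mu\<close> is carried by a countable set, whose non-atoms are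
  countably many null points.\<close>

lemma trivial_measure_mu: "trivial_measure mu"
proof -
  define S where "S = insert limit_path {Y. decidable_in empty_oracle Y}"
  have countable: "countable S" unfolding S_def using countable_decidable by simp
  have borel: "T \<in> sets borel" if "T \<subseteq> S" for T
    using singleton_borel countable_subset[OF that countable] by (rule sets.countable)
  have path: "path z \<in> S" for z unfolding S_def using support_cases[of "path z"] by blast
  then have one: "measure mu S = 1"
    using measure_mu[OF borel[of S]] lam.prob_space by simp
  have atoms: "Atoms mu \<subseteq> S"
  proof
    fix Y assume "Y \<in> Atoms mu"
    then have "0 < measure lam {z. path z \<in> {Y}}" by (simp only: Atoms_def mem_Collect_eq measure_mu[OF singleton_borel])
    then have "{z. path z \<in> {Y}} \<noteq> {}" by (metis measure_empty less_irrefl)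
    then show "Y \<in> S" using path by auto
  qed
  have "emeasure mu (S - Atoms mu) = (\<integral>\<^sup>+ Y. emeasure mu {Y} \<partial>count_space (S - Atoms mu))"
    by (rule emeasure_countable_singleton) (use countable singleton_borel in auto)
  also have "\<dots> = 0"
    by (subst nn_integral_0_iff_AE)
      (auto simp: AE_count_space Atoms_def mu.emeasure_eq_measure zero_less_measure_iff)
  finally have "measure mu (S - Atoms mu) = 0" by (simp add: measure_def)
  moreover have "measure mu (S - Atoms mu) = measure mu S - measure mu (Atoms mu)"
    by (rule mu.finite_measure_Diff) (use atoms borel in auto)
  ultimately show ?thesis unfolding trivial_measure_def using one by simp
qed

theorem corollary4p2:
  shows "\<exists>\<mu>. cantor_prob \<mu> \<and> computable_measure \<mu> \<and> trivial_measure \<mu> \<and>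
           two_MLR \<mu> = Atoms \<mu> \<and>
           MLR \<mu> - two_MLR \<mu> \<noteq> {}"
proof (intro exI conjI)
  show "cantor_prob mu" by (simp add: cantor_prob_def prob_space_mu)
  show "computable_measure mu" by (rule computable_measure_mu)
  show "trivial_measure mu" by (rule trivial_measure_mu)
  show "two_MLR mu = Atoms mu"
    using two_MLR_subset_Atoms Atoms_subset_MLR_rel unfolding two_MLR_def by blast
  then have "limit_path \<notin> two_MLR mu" using limit_path_not_atom by (simp add: Atoms_def)
  then show "MLR mu - two_MLR mu \<noteq> {}" using limit_path_MLR by blast
qed

end
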